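(* Let $0<p<2$ and let $\mu$ be a finite positive Borel measure on $[0,1)$. Then $\mathcal{C}_\mu(H^\infty)\subseteq \mathcal{Q}_p$ if and only if $\mu$ is a Carleson measure on $[0,1)$, i.e. if and only if there is a constant $C>0$ such that $\mu([t,1))\le C(1-t)$ for all $t\in[0,1)$.
   Context: Let $\mathbb{D}$ be the open unit disk in $\mathbb{C}$, let $H(\mathbb{D})$ be the space of analytic functions in $\mathbb{D}$, and let $H^\infty$ be the space of bounded analytic functions in $\mathbb{D}$. Let $dA$ be area measure on $\mathbb{C}$ normalized so that $A(\mathbb{D})=1$, and for $w\in\mathbb{D}$ let $\sigma_w(z)=\frac{w-z}{1-\overline{w}z}$. For $0\le p<\infty$, $\mathcal{Q}_p$ is the space of $f\in H(\mathbb{D})$ with $$\|f\|_{\mathcal{Q}_p}^2=\sup_{w\in\mathbb{D}}\int_{\mathbb{D}}|f'(z)|^2(1-|\sigma_w(z)|^2)^p\,dA(z)<\infty.$$ For a finite positive Borel measure $\mu$ on $[0,1)$ and an integer $n\ge 0$, let $\mu_n=\int_{[0,1)}t^n\,d\mu(t)$. The Cesàro-like operator $\mathcal{C}_\mu$ is defined on $f(z)=\sum_{n=0}^\infty a_nz^n\in H(\mathbb{D})$ by $$\mathcal{C}_\mu(f)(z)=\sum_{n=0}^\infty\Big(\mu_n\sum_{k=0}^n a_k\Big)z^n,\qquad z\in\mathbb{D}.$$ *)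

theory Defs
  imports "HOL-Complex_Analysis.Complex_Analysis"
begin

abbreviation unit_disk :: "complex set" ("\<bbbD>") where
  "\<bbbD> \<equiv> ball 0 1"

definition area_measure :: "complex measure" where
  "area_measure = scale_measure (ennreal (1 / pi)) lborel"

lemma emeasure_area_measure_unit_disk: "emeasure area_measure \<bbbD> = 1"
proof -
  have "unit_ball_vol (real DIM(complex)) = pi"
    using unit_ball_vol_2 by simp
  then have "emeasure lborel \<bbbD> = ennreal pi"
    by (simp add: emeasure_ball)
  then show ?thesis
    by (simp add: area_measure_def flip: ennreal_mult)
qed

text \<open>Function spaces on the disk are sets of total functions constrained only on \<^term>\<open>\<bbbD>\<close>.\<close>

definition Hardy_infty :: "(complex \<Rightarrow> complex) set" where
  "Hardy_infty = {f. f holomorphic_on \<bbbD> \<and> bounded (f ` \<bbbD>)}"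

definition disk_involution :: "complex \<Rightarrow> complex \<Rightarrow> complex" where
  "disk_involution w z = (w - z) / (1 - cnj w * z)"

text \<open>The value is the square of the seminorm, possibly infinite.\<close>

definition Q_seminorm_sq :: "real \<Rightarrow> (complex \<Rightarrow> complex) \<Rightarrow> ennreal" where
  "Q_seminorm_sq p f =
     (SUP w\<in>\<bbbD>. \<integral>\<^sup>+z\<in>\<bbbD>. ennreal ((cmod (deriv f z))\<^sup>2 *
        (1 - (cmod (disk_involution w z))\<^sup>2) powr p) \<partial>area_measure)"

definition Q_space :: "real \<Rightarrow> (complex \<Rightarrow> complex) set" where
  "Q_space p = {f. f holomorphic_on \<bbbD> \<and> Q_seminorm_sq p f < \<infinity>}"

definition finite_borel_measure_on :: "real set \<Rightarrow> real measure \<Rightarrow> bool" where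
  "finite_borel_measure_on S \<mu> \<longleftrightarrow>
     finite_measure \<mu> \<and> sets \<mu> = sets (restrict_space borel S)"

definition moment :: "real measure \<Rightarrow> nat \<Rightarrow> real" where
  "moment \<mu> n = (\<integral>t. t ^ n \<partial>\<mu>)"

text \<open>
  The coefficients of \<^term>\<open>fps_expansion f 0\<close> are the Taylor coefficients of \<^term>\<open>f\<close> at
  the origin. For \<^term>\<open>f\<close> holomorphic on \<^term>\<open>\<bbbD>\<close> and \<^term>\<open>\<mu>\<close> a finite Borel measure
  on \<^term>\<open>{0..<1::real}\<close> the series converges on \<^term>\<open>\<bbbD>\<close>; its values elsewhere play no role.
\<close>

definition cesaro_like ::
    "real measure \<Rightarrow> (complex \<Rightarrow> complex) \<Rightarrow> complex \<Rightarrow> complex" where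
  "cesaro_like \<mu> f z =
     (\<Sum>n. of_real (moment \<mu> n) * (\<Sum>k\<le>n. fps_nth (fps_expansion f 0) k) * z ^ n)"

definition carleson_measure_on_unit_interval :: "real measure \<Rightarrow> bool" where
  "carleson_measure_on_unit_interval \<mu> \<longleftrightarrow>
     (\<exists>C>0. \<forall>t\<in>{0..<1}. measure \<mu> {t..<1} \<le> C * (1 - t))"

end

theory Submission
  imports Defs
begin

text \<open>
  Write \<open>g\<close> for the image of \<open>f\<close> and \<open>h z = f z / (1 - z)\<close>, whose Taylor coefficients are the
  partial sums of those of \<open>f\<close>. Then \<open>g' z = \<integral> t h'(t z) d\<mu>(t)\<close>.

  If \<open>f = 1\<close>, the integrand is \<open>t / (1 - t z)\<^sup>2\<close>, whose real part is positive and at least a constant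
  times \<open>(1 - x)\<close> to the power \<open>-2\<close> for \<open>t \<ge> x\<close> and \<open>z\<close> in the disk of radius \<open>(1 - x) / 4\<close> about \<open>x\<close>.
  Testing the seminorm at \<open>w = x\<close> on this disk gives \<open>\<mu> [x, 1) = O(1 - x)\<close>.

  Conversely, for bounded \<open>f\<close> Cauchy's estimate bounds \<open>|h'(u)|\<close> by a multiple of
  \<open>1 / ((1 - |u|) |1 - u|)\<close>. Trading a power \<open>\<epsilon> = p/4\<close> between the two factors, the Carleson condition
  yields \<open>|g' z|\<^sup>2 \<le> C (1 - |z|) powr (- p/2) * |1 - z| powr (p/2 - 2)\<close>. The integral of this
  bound against the weight is bounded uniformly in \<open>w\<close>, by comparing \<open>|1 - z|\<close>
  with \<open>|1 - w|\<close>. All integrals of powers, against \<open>\<mu>\<close> or area, reduce to summing over dyadic shells.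
\<close>

section \<open>Integrals of powers over dyadic shells\<close>

text \<open>On the shell \<open>r k \<le> \<rho> x < 2 * r k\<close> the power is at most
  \<open>r k powr - a\<close>, and the shell lies in a sublevel set of measure at most
  \<open>C * (2 * r k) powr m\<close>, so it contributes at most a multiple of
  \<open>r k powr (m - a)\<close>. The exponent \<open>m\<close> acts as a dimension: 2 for area, 1
  for a Carleson measure. The radii are left free so that they can be doubled or halved.\<close>

lemma nn_integral_dyadic_shells:
  fixes \<rho> :: "'a \<Rightarrow> real" and r :: "nat \<Rightarrow> real"
  assumes [measurable]: "\<rho> \<in> borel_measurable M"
    and growth: "\<And>s. s > 0 \<Longrightarrow> emeasure M {x \<in> space M. \<rho> x < s} \<le> ennreal (C * s powr m)"
    and "C \<ge> 0" "a \<ge> 0" and r: "\<And>k. r k > 0"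
    and sums: "(\<lambda>k. r k powr (m - a)) sums S"
  shows "(\<integral>\<^sup>+x. ennreal (\<rho> x powr - a) * indicator {x. \<exists>k. r k \<le> \<rho> x \<and> \<rho> x < 2 * r k} x \<partial>M)
    \<le> ennreal (C * 2 powr m * S)"
proof -
  let ?E = "\<lambda>k. {x \<in> space M. \<rho> x < 2 * r k}"
  have "(\<integral>\<^sup>+x. ennreal (\<rho> x powr - a) * indicator {x. \<exists>k. r k \<le> \<rho> x \<and> \<rho> x < 2 * r k} x \<partial>M)
      \<le> (\<integral>\<^sup>+x. (\<Sum>k. ennreal (r k powr - a) * indicator (?E k) x) \<partial>M)"
  proof (intro nn_integral_mono)
    fix x assume x: "x \<in> space M"
    show "ennreal (\<rho> x powr - a) * indicator {x. \<exists>k. r k \<le> \<rho> x \<and> \<rho> x < 2 * r k} x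
      \<le> (\<Sum>k. ennreal (r k powr - a) * indicator (?E k) x)"
    proof (cases "\<exists>k. r k \<le> \<rho> x \<and> \<rho> x < 2 * r k")
      case True
      then obtain k where k: "r k \<le> \<rho> x" "\<rho> x < 2 * r k" by blast
      have "\<rho> x powr - a \<le> r k powr - a"
        using k r[of k] \<open>a \<ge> 0\<close> by (intro powr_mono2') auto
      then have "ennreal (\<rho> x powr - a) * indicator {x. \<exists>k. r k \<le> \<rho> x \<and> \<rho> x < 2 * r k} x
          \<le> ennreal (r k powr - a) * indicator (?E k) x"
        using k x True by (simp add: ennreal_leI)
      also have "\<dots> = sum (\<lambda>i. ennreal (r i powr - a) * indicator (?E i) x) {k}"
        by (simp only: sum.insert sum.empty finite.emptyI empty_iff not_False_eq_True add_0_right)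
      also have "\<dots> \<le> (\<Sum>k. ennreal (r k powr - a) * indicator (?E k) x)"
        by (intro sum_le_suminf) auto
      finally show ?thesis .
    qed simp
  qed
  also have "\<dots> = (\<Sum>k. \<integral>\<^sup>+x. ennreal (r k powr - a) * indicator (?E k) x \<partial>M)"
    by (intro nn_integral_suminf) measurable
  also have "\<dots> = (\<Sum>k. ennreal (r k powr - a) * emeasure M (?E k))"
    by (subst nn_integral_cmult_indicator) auto
  also have "\<dots> \<le> (\<Sum>k. ennreal (C * 2 powr m * r k powr (m - a)))"
  proof (intro suminf_le summableI)
    fix k
    have "ennreal (r k powr - a) * emeasure M (?E k)
        \<le> ennreal (r k powr - a) * ennreal (C * (2 * r k) powr m)"
      using growth[of "2 * r k"] r[of k] by (intro mult_left_mono) auto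
    also have "\<dots> = ennreal (C * 2 powr m * r k powr (m - a))"
      using r[of k] \<open>C \<ge> 0\<close>
      by (simp add: powr_mult powr_diff powr_minus field_simps flip: ennreal_mult)
    finally show "ennreal (r k powr - a) * emeasure M (?E k)
        \<le> ennreal (C * 2 powr m * r k powr (m - a))" .
  qed
  also have "\<dots> = ennreal (C * 2 powr m * S)"
    using sums_mult[OF sums, of "C * 2 powr m"] \<open>C \<ge> 0\<close>
    by (intro suminf_ennreal_eq) auto
  finally show ?thesis .
qed

lemma dyadic_shell_exists:
  fixes y :: real
  assumes "y \<ge> 1"
  obtains k :: nat where "2 ^ k \<le> y" "y < 2 ^ Suc k"
proof -
  obtain n :: nat where n: "y < 2 ^ n"
    using real_arch_pow[of 2 y] by auto
  define N where "N = (LEAST n. y < 2 ^ n)"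
  have N: "y < 2 ^ N" unfolding N_def using n by (rule LeastI)
  then have "N \<noteq> 0" using assms by (intro notI) simp
  then obtain k where k: "N = Suc k" by (cases N) auto
  have "\<not> y < 2 ^ k"
    using not_less_Least[of k "\<lambda>n. y < 2 ^ n"] k unfolding N_def by simp
  then show ?thesis using that[of k] N k by auto
qed

lemma powr_two_geometric_sums:
  fixes R e :: real
  assumes "R > 0" "e < 0"
  shows "(\<lambda>k. (R * 2 ^ k) powr e) sums (R powr e / (1 - 2 powr e))"
proof -
  have "2 powr e < 1" using assms by (simp add: powr_less_one)
  then have "(\<lambda>k. R powr e * (2 powr e) ^ k) sums (R powr e * (1 / (1 - 2 powr e)))"
    by (intro sums_mult geometric_sums) auto
  moreover have "(R * 2 ^ k) powr e = R powr e * (2 powr e) ^ k" for k :: nat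
    using assms by (simp add: powr_mult powr_powr mult.commute flip: powr_realpow)
  ultimately show ?thesis by simp
qed

text \<open>The radii \<open>R * 2 ^ k\<close> run outward, and their powers form a convergent
  geometric series because \<open>m < a\<close>.\<close>

lemma nn_integral_powr_outside:
  fixes \<rho> :: "'a \<Rightarrow> real"
  assumes "\<rho> \<in> borel_measurable M"
    and "\<And>s. s > 0 \<Longrightarrow> emeasure M {x \<in> space M. \<rho> x < s} \<le> ennreal (C * s powr m)"
    and "C \<ge> 0" "0 \<le> a" "m < a" "R > 0"
  shows "(\<integral>\<^sup>+x. ennreal (\<rho> x powr - a) * indicator {x. R \<le> \<rho> x} x \<partial>M)
    \<le> ennreal (C * 2 powr m / (1 - 2 powr (m - a)) * R powr (m - a))"
proof -
  let ?r = "\<lambda>k. R * 2 ^ k :: real"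
  have sums: "(\<lambda>k. ?r k powr (m - a)) sums (R powr (m - a) / (1 - 2 powr (m - a)))"
    using assms by (intro powr_two_geometric_sums) auto
  have "\<exists>k. ?r k \<le> \<rho> x \<and> \<rho> x < 2 * ?r k" if "R \<le> \<rho> x" for x
  proof -
    have "\<rho> x / R \<ge> 1" using that \<open>R > 0\<close> by simp
    then obtain k where "2 ^ k \<le> \<rho> x / R" "\<rho> x / R < 2 ^ Suc k"
      by (rule dyadic_shell_exists)
    then show ?thesis using \<open>R > 0\<close> by (intro exI[of _ k]) (auto simp: field_simps)
  qed
  then have "(\<integral>\<^sup>+x. ennreal (\<rho> x powr - a) * indicator {x. R \<le> \<rho> x} x \<partial>M)
    \<le> (\<integral>\<^sup>+x. ennreal (\<rho> x powr - a) * indicator {x. \<exists>k. ?r k \<le> \<rho> x \<and> \<rho> x < 2 * ?r k} x \<partial>M)"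
    by (intro nn_integral_mono mult_left_mono) (auto simp: indicator_def)
  also have "\<dots> \<le> ennreal (C * 2 powr m * (R powr (m - a) / (1 - 2 powr (m - a))))"
    using assms sums by (intro nn_integral_dyadic_shells) auto
  finally show ?thesis by simp
qed

text \<open>The radii \<open>R / 2 ^ Suc k\<close> shrink to zero, and the series converges because
  the singularity \<open>a\<close> is weaker than the dimension \<open>m\<close>.\<close>

lemma nn_integral_powr_inside:
  fixes \<rho> :: "'a \<Rightarrow> real"
  assumes "\<rho> \<in> borel_measurable M"
    and "\<And>s. s > 0 \<Longrightarrow> emeasure M {x \<in> space M. \<rho> x < s} \<le> ennreal (C * s powr m)"
    and nonneg: "\<And>x. \<rho> x \<ge> 0 \<or> x \<notin> space M"
    and "C \<ge> 0" "0 \<le> a" "a < m" "R > 0"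
  shows "(\<integral>\<^sup>+x. ennreal (\<rho> x powr - a) * indicator {x. \<rho> x < R} x \<partial>M)
    \<le> ennreal (C * 2 powr a / (1 - 2 powr (a - m)) * R powr (m - a))"
proof -
  let ?r = "\<lambda>k. R / 2 ^ Suc k :: real"
  have eq: "?r k powr (m - a) = (2 / R * 2 ^ k) powr (a - m)" for k :: nat
  proof -
    have "(2 / R * 2 ^ k) powr (a - m) = inverse (2 / R * 2 ^ k) powr (m - a)"
      using powr_minus[of "2 / R * 2 ^ k" "m - a"] \<open>R > 0\<close>
      by (subst inverse_powr) auto
    also have "inverse (2 / R * 2 ^ k) = ?r k" by (simp add: field_simps)
    finally show ?thesis by simp
  qed
  have sums: "(\<lambda>k. ?r k powr (m - a)) sums ((2 / R) powr (a - m) / (1 - 2 powr (a - m)))"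
    unfolding eq using assms by (intro powr_two_geometric_sums) auto
  have shell: "\<exists>k. ?r k \<le> \<rho> x \<and> \<rho> x < 2 * ?r k" if "\<rho> x < R" "0 < \<rho> x" for x
  proof -
    have "R / \<rho> x \<ge> 1" using that by simp
    then obtain k where k: "2 ^ k \<le> R / \<rho> x" "R / \<rho> x < 2 ^ Suc k"
      by (rule dyadic_shell_exists)
    \<comment> \<open>Inverting \<open>2 ^ k \<le> R / \<rho> x < 2 ^ Suc k\<close> gives an
      interval closed at its upper end, whereas shells are closed at the lower end. The endpoint
      \<open>\<rho> x = R / 2 ^ k\<close> thus belongs to the next shell outward, of index
      \<open>k - 1\<close>, which exists since \<open>\<rho> x < R\<close>.\<close>
    show ?thesis
    proof (cases "2 ^ k = R / \<rho> x")
      case True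
      then have "k \<noteq> 0" using that by (intro notI) (auto simp: field_simps)
      then obtain j where "k = Suc j" by (cases k) auto
      then show ?thesis using True that \<open>R > 0\<close>
        by (intro exI[of _ j]) (auto simp: field_simps)
    next
      case False
      then show ?thesis using k that \<open>R > 0\<close> by (intro exI[of _ k]) (auto simp: field_simps)
    qed
  qed
  have "(\<integral>\<^sup>+x. ennreal (\<rho> x powr - a) * indicator {x. \<rho> x < R} x \<partial>M)
    \<le> (\<integral>\<^sup>+x. ennreal (\<rho> x powr - a) * indicator {x. \<exists>k. ?r k \<le> \<rho> x \<and> \<rho> x < 2 * ?r k} x \<partial>M)"
  proof (intro nn_integral_mono)
    fix x assume "x \<in> space M"
    \<comment> \<open>Zeros of \<open>\<rho>\<close> lie in no shell, but there
      \<open>0 powr - a = 0\<close>, so the integrand vanishes.\<close>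
    then have "\<rho> x = 0 \<or> \<rho> x > 0" using nonneg[of x] by auto
    then show "ennreal (\<rho> x powr - a) * indicator {x. \<rho> x < R} x
      \<le> ennreal (\<rho> x powr - a) * indicator {x. \<exists>k. ?r k \<le> \<rho> x \<and> \<rho> x < 2 * ?r k} x"
      using shell[of x] by (auto simp: indicator_def)
  qed
  also have "\<dots> \<le> ennreal (C * 2 powr m * ((2 / R) powr (a - m) / (1 - 2 powr (a - m))))"
    using assms sums by (intro nn_integral_dyadic_shells) auto
  also have "C * 2 powr m * ((2 / R) powr (a - m) / (1 - 2 powr (a - m)))
      = C * 2 powr a / (1 - 2 powr (a - m)) * R powr (m - a)"
    using \<open>R > 0\<close> by (simp add: powr_divide powr_diff mult_ac)
  finally show ?thesis .
qed

section \<open>The derivative of the image\<close>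

lemma finite_borel_measure_on_unit_intervalD:
  assumes "finite_borel_measure_on {0..<1} \<mu>"
  shows "finite_measure \<mu>" "space \<mu> = {0..<1}"
    "\<And>g :: real \<Rightarrow> 'b :: topological_space. g \<in> borel_measurable borel \<Longrightarrow> g \<in> borel_measurable \<mu>"
    "\<And>x. {x..<1} \<inter> {0..<1} \<in> sets \<mu>"
proof -
  have sets: "sets \<mu> = sets (restrict_space borel {0..<1})"
    using assms by (simp add: finite_borel_measure_on_def)
  show "finite_measure \<mu>" using assms by (simp add: finite_borel_measure_on_def)
  show "space \<mu> = {0..<1}" using sets_eq_imp_space_eq[OF sets] by (simp add: space_restrict_space)
  show "g \<in> borel_measurable \<mu>" if "g \<in> borel_measurable borel"
    for g :: "real \<Rightarrow> 'b :: topological_space"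
    using measurable_restrict_space1[OF that] measurable_cong_sets[OF sets refl] by blast
  show "{x..<1} \<inter> {0..<1} \<in> sets \<mu>" for x
    unfolding sets by (auto simp: sets_restrict_space)
qed

text \<open>Writing each moment as an integral and differentiating termwise, sum and integral may be
  exchanged because \<open>t \<le> 1\<close> on the support and the Taylor series of the derivative
  of \<open>h\<close> converges absolutely at \<open>z\<close>. Integrability is stated separately
  since real parts and norms are later taken under the integral.\<close>

lemma cesaro_like_deriv:
  fixes \<mu> :: "real measure" and f :: "complex \<Rightarrow> complex"
  assumes \<mu>: "finite_borel_measure_on {0..<1} \<mu>" and f: "f holomorphic_on \<bbbD>"
  defines "h \<equiv> (\<lambda>z. f z / (1 - z))"
  shows "cesaro_like \<mu> f holomorphic_on \<bbbD>"
    and "\<And>z. z \<in> \<bbbD> \<Longrightarrow> integrable \<mu> (\<lambda>t. of_real t * deriv h (of_real t * z))"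
    and "\<And>z. z \<in> \<bbbD> \<Longrightarrow>
      deriv (cesaro_like \<mu> f) z = (\<integral>t. of_real t * deriv h (of_real t * z) \<partial>\<mu>)"
proof -
  interpret finite_measure \<mu> using \<mu> by (rule finite_borel_measure_on_unit_intervalD)
  note sp = finite_borel_measure_on_unit_intervalD(2)[OF \<mu>]
  note meas = finite_borel_measure_on_unit_intervalD(3)[OF \<mu>]
  define H where "H = Abs_fps (\<lambda>n. \<Sum>k\<le>n. fps_nth (fps_expansion f 0) k)"
  define G where "G = Abs_fps (\<lambda>n. of_real (moment \<mu> n) * fps_nth H n)"
  have h_holo: "h holomorphic_on \<bbbD>"
    unfolding h_def by (intro holomorphic_intros f) auto
  \<comment> \<open>Division by \<open>1 - fps_X\<close> turns coefficients into their partial sums,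
    which identifies \<open>H\<close>.\<close>
  have "(\<lambda>z. f z / (1 - z)) has_fps_expansion (fps_expansion f 0 / (1 - fps_X))"
    by (intro fps_expansion_intros has_fps_expansion_fps_expansion[OF _ _ f]) auto
  then have hH: "h has_fps_expansion H"
    by (simp add: h_def H_def fps_divide_fps_X_minus1_sum atLeast0AtMost)
  have ball: "\<bbbD> = eball 0 (ereal 1)" by simp
  have H_rad: "fps_conv_radius H \<ge> ereal 1"
    using holomorphic_on_imp_fps_conv_radius_ge[OF hH] h_holo unfolding ball by blast
  have eval_H: "eval_fps H z = h z" if "z \<in> \<bbbD>" for z
    using has_fps_expansion_imp_eval_fps_eq[OF hH _ h_holo] that by simp
  have int_pow: "integrable \<mu> (\<lambda>t. t ^ n)" for n
    by (rule integrable_const_bound[of _ 1]) (auto intro!: meas AE_I2 simp: sp power_le_one power_abs)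
  have moment_le: "\<bar>moment \<mu> n\<bar> \<le> measure \<mu> (space \<mu>)" for n
  proof -
    have "\<bar>moment \<mu> n\<bar> \<le> (\<integral>t. \<bar>t ^ n\<bar> \<partial>\<mu>)"
      unfolding moment_def by (rule integral_abs_bound)
    also have "\<dots> \<le> (\<integral>t. 1 \<partial>\<mu>)"
      by (intro integral_mono integrable_abs int_pow) (auto simp: sp power_le_one)
    finally show ?thesis by simp
  qed
  \<comment> \<open>The moments are bounded by the total mass, so passing from \<open>H\<close> to
    \<open>G\<close> preserves absolute convergence in the disk.\<close>
  have G_rad: "fps_conv_radius G \<ge> ereal 1"
    unfolding fps_conv_radius_def
  proof (rule conv_radius_geI_ex')
    fix r :: real assume r: "0 < r" "ereal r < ereal 1"
    have "ereal (norm (of_real r :: complex)) < fps_conv_radius H"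
      using r by (intro less_le_trans[OF _ H_rad]) auto
    then have "summable (\<lambda>n. norm (fps_nth H n * of_real r ^ n))"
      unfolding fps_conv_radius_def by (rule abs_summable_in_conv_radius)
    then have "summable (\<lambda>n. measure \<mu> (space \<mu>) * norm (fps_nth H n * of_real r ^ n))"
      by (rule summable_mult)
    then show "summable (\<lambda>n. fps_nth G n * of_real r ^ n)"
      by (rule summable_comparison_test'[where N = 0])
        (auto simp: G_def norm_mult mult.assoc intro!: mult_right_mono moment_le)
  qed
  have ces: "cesaro_like \<mu> f = eval_fps G"
    by (auto simp: fun_eq_iff cesaro_like_def eval_fps_def G_def H_def)
  have H_norm: "ereal (norm z) < fps_conv_radius H" if "z \<in> \<bbbD>" for z
    using that by (intro less_le_trans[OF _ H_rad]) simp
  have G_norm: "ereal (norm z) < fps_conv_radius G" if "z \<in> \<bbbD>" for z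
    using that by (intro less_le_trans[OF _ G_rad]) simp
  show "cesaro_like \<mu> f holomorphic_on \<bbbD>"
    unfolding ces by (intro holomorphic_on_eval_fps subsetI) (simp only: in_eball_iff dist_0_norm G_norm)
  fix z :: complex assume z: "z \<in> \<bbbD>"
  let ?c = "\<lambda>n. fps_nth (fps_deriv H) n * z ^ n"
  \<comment> \<open>The power is \<open>Suc n\<close>: \<open>n\<close> factors come from the
    argument \<open>t z\<close> of the derivative and one from the outer factor
    \<open>t\<close>.\<close>
  let ?F = "\<lambda>n t. of_real (t ^ Suc n) * ?c n :: complex"
  have "ereal (norm z) < fps_conv_radius (fps_deriv H)"
    by (rule less_le_trans[OF H_norm[OF z] fps_conv_radius_deriv])
  then have c_sum: "summable (\<lambda>n. norm (?c n))"
    unfolding fps_conv_radius_def by (rule abs_summable_in_conv_radius)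
  have F_int: "integrable \<mu> (?F n)" for n
    by (intro integrable_mult_left integrable_of_real int_pow)
  have F_le: "norm (?F n t) \<le> norm (?c n)" if "t \<in> space \<mu>" for n t
  proof -
    have "norm (of_real (t ^ Suc n) :: complex) \<le> 1"
      unfolding norm_of_real using that by (simp add: sp power_le_one mult_le_one abs_mult)
    then have "norm (of_real (t ^ Suc n) :: complex) * norm (?c n) \<le> 1 * norm (?c n)"
      by (rule mult_right_mono) simp
    then show ?thesis by (simp only: norm_mult mult_1)
  qed
  have F_sum: "AE t in \<mu>. summable (\<lambda>n. norm (?F n t))"
  proof (rule AE_I2)
    fix t assume "t \<in> space \<mu>"
    with F_le c_sum show "summable (\<lambda>n. norm (?F n t))"
      by (intro summable_comparison_test'[OF c_sum]) auto
  qed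
  have F_int_sum: "summable (\<lambda>n. \<integral>t. norm (?F n t) \<partial>\<mu>)"
  proof (rule summable_comparison_test'[where N = 0])
    show "summable (\<lambda>n. norm (?c n) * measure \<mu> (space \<mu>))"
      using c_sum by (rule summable_mult2)
    fix n
    have "(\<integral>t. norm (?F n t) \<partial>\<mu>) \<le> (\<integral>t. norm (?c n) \<partial>\<mu>)"
      by (intro integral_mono integrable_norm F_int F_le) auto
    then show "norm (\<integral>t. norm (?F n t) \<partial>\<mu>) \<le> norm (?c n) * measure \<mu> (space \<mu>)"
      by (simp add: mult.commute)
  qed
  have eq: "(\<Sum>n. ?F n t) = of_real t * deriv h (of_real t * z)" if "t \<in> space \<mu>" for t
  proof -
    have tz: "of_real t * z \<in> \<bbbD>"
    proof -
      have "\<bar>t\<bar> * norm z \<le> 1 * norm z" using that by (intro mult_right_mono) (auto simp: sp)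
      then show ?thesis using z by (simp add: norm_mult)
    qed
    then have rad: "ereal (norm (of_real t * z)) < fps_conv_radius H"
      by (rule H_norm)
    have "(\<Sum>n. ?F n t) = (\<Sum>n. of_real t * (fps_nth (fps_deriv H) n * (of_real t * z) ^ n))"
      by (simp add: power_mult_distrib mult_ac)
    also have "\<dots> = of_real t * (\<Sum>n. fps_nth (fps_deriv H) n * (of_real t * z) ^ n)"
      using less_le_trans[OF rad fps_conv_radius_deriv]
      by (intro suminf_mult summable_in_conv_radius) (auto simp: fps_conv_radius_def)
    also have "(\<Sum>n. fps_nth (fps_deriv H) n * (of_real t * z) ^ n)
        = eval_fps (fps_deriv H) (of_real t * z)"
      by (simp add: eval_fps_def)
    also have "\<dots> = deriv (eval_fps H) (of_real t * z)"
      by (rule eval_fps_deriv[OF rad])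
    \<comment> \<open>The power series and \<open>h\<close> are known to agree only inside the disk,
      so their derivatives are compared through agreement near the point.\<close>
    also have "\<dots> = deriv h (of_real t * z)"
    proof (rule deriv_cong_ev)
      have "eventually (\<lambda>x. x \<in> \<bbbD>) (nhds (of_real t * z))"
        using tz by (intro eventually_nhds_in_open) auto
      then show "\<forall>\<^sub>F x in nhds (of_real t * z). eval_fps H x = h x"
        by eventually_elim (rule eval_H)
    qed simp
    finally show ?thesis .
  qed
  have "integrable \<mu> (\<lambda>t. \<Sum>n. ?F n t)"
    by (rule integrable_suminf[OF F_int F_sum F_int_sum])
  then show "integrable \<mu> (\<lambda>t. of_real t * deriv h (of_real t * z))"
    by (subst Bochner_Integration.integrable_cong[OF refl eq[symmetric]])
  have "deriv (cesaro_like \<mu> f) z = eval_fps (fps_deriv G) z"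
    unfolding ces by (intro eval_fps_deriv[symmetric] G_norm z)
  also have "\<dots> = (\<Sum>n. \<integral>t. ?F n t \<partial>\<mu>)"
    unfolding eval_fps_def
  proof (intro suminf_cong)
    fix n
    have "(\<integral>t. ?F n t \<partial>\<mu>) = (\<integral>t. of_real (t ^ Suc n) \<partial>\<mu>) * ?c n"
      by (rule integral_mult_left_zero)
    also have "(\<integral>t. of_real (t ^ Suc n) \<partial>\<mu>) = (of_real (moment \<mu> (Suc n)) :: complex)"
      unfolding moment_def by (rule integral_complex_of_real)
    finally show "fps_nth (fps_deriv G) n * z ^ n = (\<integral>t. ?F n t \<partial>\<mu>)"
      by (simp add: G_def mult_ac)
  qed
  also have "\<dots> = (\<integral>t. (\<Sum>n. ?F n t) \<partial>\<mu>)"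
    by (rule integral_suminf[OF F_int F_sum F_int_sum, symmetric])
  also have "\<dots> = (\<integral>t. of_real t * deriv h (of_real t * z) \<partial>\<mu>)"
    by (rule Bochner_Integration.integral_cong[OF refl eq])
  finally show "deriv (cesaro_like \<mu> f) z = (\<integral>t. of_real t * deriv h (of_real t * z) \<partial>\<mu>)" .
qed

section \<open>Necessity of the Carleson condition\<close>

lemma emeasure_area_measure_ball:
  assumes "r \<ge> 0"
  shows "emeasure area_measure (ball v r) = ennreal (r\<^sup>2)"
proof -
  have "unit_ball_vol (real DIM(complex)) = pi" using unit_ball_vol_2 by simp
  then have "emeasure lborel (ball v r) = ennreal (pi * r\<^sup>2)"
    using assms by (simp add: emeasure_ball)
  then show ?thesis by (simp add: area_measure_def flip: ennreal_mult)
qed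

lemma sets_area_measure [simp, measurable_cong]: "sets area_measure = sets borel"
  by (simp add: area_measure_def)

lemma space_area_measure [simp]: "space area_measure = UNIV"
  using sets_eq_imp_space_eq[OF sets_area_measure] by simp

text \<open>The last bound holds because \<open>1 - z\<close> differs from
  \<open>1 - of_real t * z\<close> by a term of norm at most \<open>1 - t\<close>, which the
  preceding bounds absorb.\<close>

lemma norm_one_minus_mult_bounds:
  fixes z :: complex and t :: real
  assumes "0 \<le> t" "t < 1" "norm z < 1"
  shows "1 - t \<le> 1 - t * norm z" "1 - norm z \<le> 1 - t * norm z"
    "1 - t * norm z \<le> norm (1 - of_real t * z)" "norm (1 - z) \<le> 2 * norm (1 - of_real t * z)"
proof -
  show 1: "1 - t \<le> 1 - t * norm z"
    using mult_left_mono[of "norm z" 1 t] assms by simp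
  show "1 - norm z \<le> 1 - t * norm z"
    using mult_right_mono[of t 1 "norm z"] assms by simp
  show 2: "1 - t * norm z \<le> norm (1 - of_real t * z)"
    using norm_triangle_ineq2[of 1 "of_real t * z"] assms by (simp add: norm_mult)
  have "norm (1 - z) = norm ((1 - of_real t * z) - of_real (1 - t) * z)"
    by (simp add: algebra_simps)
  also have "\<dots> \<le> norm (1 - of_real t * z) + norm (of_real (1 - t) * z)"
    by (rule norm_triangle_ineq4)
  also have "norm (of_real (1 - t) * z) = (1 - t) * norm z"
    unfolding norm_mult norm_of_real using assms by simp
  also have "(1 - t) * norm z \<le> 1 - t"
    using mult_left_mono[of "norm z" 1 "1 - t"] assms by simp
  finally show "norm (1 - z) \<le> 2 * norm (1 - of_real t * z)"
    using 1 2 by simp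
qed

text \<open>With \<open>u = a + i b\<close> the real part is
  \<open>(a\<^sup>2 - b\<^sup>2) / (a\<^sup>2 + b\<^sup>2)\<^sup>2\<close>. Closeness to
  \<open>r\<close> forces \<open>a\<close> to dominate \<open>b\<close>, so the numerator is
  comparable to the square of \<open>r\<close> and the denominator to its fourth power.\<close>

lemma Re_inverse_square_ge:
  fixes u :: complex
  assumes "0 < r" and "norm (u - of_real r) \<le> r / 4"
  shows "1 / (5 * r\<^sup>2) \<le> Re (1 / u\<^sup>2)"
proof -
  define a b where "a = Re u" and "b = Im u"
  have ab: "\<bar>a - r\<bar> \<le> r / 4" "\<bar>b\<bar> \<le> r / 4"
    using abs_Re_le_cmod[of "u - of_real r"] abs_Im_le_cmod[of "u - of_real r"] assms
    by (auto simp: a_def b_def)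
  have "norm u \<le> 5 / 4 * r"
    using norm_triangle_ineq[of "u - of_real r" "of_real r"] assms by simp
  then have "(norm u)\<^sup>2 \<le> (5 / 4 * r)\<^sup>2" by (intro power_mono) auto
  then have sq: "a\<^sup>2 + b\<^sup>2 \<le> 25 / 16 * r\<^sup>2"
    unfolding cmod_power2 a_def b_def by (simp add: power_mult_distrib power_divide)
  have "3 / 4 * r \<le> a" using ab(1) by linarith
  then have "(3 / 4 * r)\<^sup>2 \<le> a\<^sup>2" using assms(1) by (intro power_mono) simp_all
  moreover have "\<bar>b\<bar>\<^sup>2 \<le> (r / 4)\<^sup>2" using ab(2) by (rule power_mono) simp
  ultimately have diff: "r\<^sup>2 / 2 \<le> a\<^sup>2 - b\<^sup>2"
    by (simp add: power_mult_distrib power_divide)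
  have "0 < r\<^sup>2" using assms(1) by simp
  then have pos: "a\<^sup>2 + b\<^sup>2 > 0" using diff zero_le_power2[of b] by linarith
  have "(a\<^sup>2 + b\<^sup>2)\<^sup>2 \<le> (25 / 16 * r\<^sup>2)\<^sup>2" using sq by (rule power_mono) simp
  \<comment> \<open>This fixes the constant 5: the square of 25/16 is 625/256, just below 5/2 =
    640/256.\<close>
  also have "\<dots> \<le> 5 * r\<^sup>2 * (r\<^sup>2 / 2)"
    using assms(1) by (simp add: power2_eq_square zero_le_mult_iff)
  also have "\<dots> \<le> 5 * r\<^sup>2 * (a\<^sup>2 - b\<^sup>2)"
    using diff by (rule mult_left_mono) simp
  finally have le: "(a\<^sup>2 + b\<^sup>2)\<^sup>2 \<le> 5 * r\<^sup>2 * (a\<^sup>2 - b\<^sup>2)" .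
  have frac: "1 / X \<le> c / Y" if "Y \<le> X * c" "X > 0" "Y > 0" for X Y c :: real
    using that by (simp add: field_simps)
  have "1 / (5 * r\<^sup>2) \<le> (a\<^sup>2 - b\<^sup>2) / (a\<^sup>2 + b\<^sup>2)\<^sup>2"
    using assms(1) by (intro frac[OF le _ zero_less_power[OF pos]]) simp
  also have "\<dots> = Re (1 / u\<^sup>2)"
  proof -
    have "(a\<^sup>2 - b\<^sup>2)\<^sup>2 + (2 * a * b)\<^sup>2 = (a\<^sup>2 + b\<^sup>2)\<^sup>2" by algebra
    then show ?thesis
      by (simp add: Re_divide a_def b_def Re_power2 Im_power2)
  qed
  finally show ?thesis .
qed

text \<open>With \<open>m\<close> the mass of \<open>[x, 1)\<close>, the derivative is at least of
  order \<open>m / (1 - x)\<^sup>2\<close> on a disk of area of order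
  \<open>(1 - x)\<^sup>2\<close>. Squaring and integrating bounds
  \<open>m\<^sup>2 / (1 - x)\<^sup>2\<close> by the seminorm.\<close>

lemma carleson_if_cesaro_like_one_in_Q:
  fixes \<mu> :: "real measure" and p :: real
  assumes \<mu>: "finite_borel_measure_on {0..<1} \<mu>" and "p > 0"
    and Q: "cesaro_like \<mu> (\<lambda>_. 1) \<in> Q_space p"
  shows "carleson_measure_on_unit_interval \<mu>"
proof -
  interpret finite_measure \<mu> using \<mu> by (rule finite_borel_measure_on_unit_intervalD)
  note sp = finite_borel_measure_on_unit_intervalD(2)[OF \<mu>]
  let ?g = "cesaro_like \<mu> (\<lambda>_. 1)"
  have "Q_seminorm_sq p ?g < \<infinity>" using Q by (simp add: Q_space_def)
  then obtain S where S: "S \<ge> 0" "Q_seminorm_sq p ?g = ennreal S"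
    by (cases "Q_seminorm_sq p ?g") auto
  have deriv_h: "deriv (\<lambda>z. 1 / (1 - z)) u = 1 / (1 - u)\<^sup>2" if "norm u < 1" for u :: complex
  proof -
    have "u \<noteq> 1" using that by auto
    then show ?thesis
      by (intro DERIV_imp_deriv) (auto intro!: derivative_eq_intros simp: power2_eq_square)
  qed
  have tz_le: "norm (of_real t * z) < 1" if "t \<in> {0..<1}" "norm z < 1" for t and z :: complex
    using norm_one_minus_mult_bounds(2)[of t z] that by (simp add: norm_mult)
  \<comment> \<open>The constant 25600 is the square of 40 * 4, from the lower bound on the
    derivative and the radius \<open>\<delta> / 4\<close>; \<open>2 powr p\<close> undoes the lower
    bound on the weight. Taking \<open>x \<ge> 1/2\<close> keeps the factor \<open>t\<close> of the
    integrand away from zero for \<open>t \<ge> x\<close>.\<close>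
  have bound: "measure \<mu> {x..<1} \<le> sqrt (25600 * 2 powr p * S) * (1 - x)" if x: "1/2 \<le> x" "x < 1" for x
  proof -
    define \<delta> m where "\<delta> = 1 - x" and "m = measure \<mu> {x..<1}"
    have \<delta>: "\<delta> > 0" "\<delta> \<le> 1/2" using x by (auto simp: \<delta>_def)
    have x_set: "{x..<1} \<in> sets \<mu>"
    proof -
      have "{x..<1} \<inter> {0..<1} = {x..<1}" using x by auto
      then show ?thesis using finite_borel_measure_on_unit_intervalD(4)[OF \<mu>, of x] by simp
    qed
    let ?B = "ball (of_real x :: complex) (\<delta> / 4)"
    have B: "norm (z - of_real x) < \<delta> / 4" "norm z < 1" if "z \<in> ?B" for z
    proof -
      show 1: "norm (z - of_real x) < \<delta> / 4" using that by (simp add: dist_norm norm_minus_commute)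
      have "norm z \<le> norm (z - of_real x) + norm (of_real x :: complex)"
        using norm_triangle_ineq[of "z - of_real x" "of_real x"] by simp
      then show "norm z < 1" using 1 x \<delta> by (simp add: \<delta>_def)
    qed
    \<comment> \<open>The constant 40 is 5 * 4 * 2: from \<open>Re_inverse_square_ge\<close>, from
      \<open>r \<le> 2 * \<delta>\<close>, and from \<open>t \<ge> 1/2\<close>.\<close>
    have deriv_ge: "m / (40 * \<delta>\<^sup>2) \<le> norm (deriv ?g z)" if z: "z \<in> ?B" for z
    proof -
      let ?k = "\<lambda>t. of_real t * deriv (\<lambda>z. 1 / (1 - z)) (of_real t * z)"
      have zD: "z \<in> \<bbbD>" using B[OF z] by simp
      have int: "integrable \<mu> ?k"
        by (rule cesaro_like_deriv(2)[OF \<mu> _ zD]) simp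
      have "m / (40 * \<delta>\<^sup>2) = (\<integral>t. 1 / (40 * \<delta>\<^sup>2) * indicator {x..<1} t \<partial>\<mu>)"
        using x_set x by (simp add: m_def sp max_def)
      \<comment> \<open>The real part of the integrand is nonnegative for every \<open>t\<close>, so
        the range \<open>t < x\<close> can be discarded without cancellation.\<close>
      also have "\<dots> \<le> (\<integral>t. Re (?k t) \<partial>\<mu>)"
      proof (intro integral_mono)
        show "integrable \<mu> (\<lambda>t. 1 / (40 * \<delta>\<^sup>2) * indicator {x..<1} t)"
          using x_set by (intro integrable_mult_right integrable_real_indicator) (auto simp: emeasure_eq_measure)
        show "integrable \<mu> (\<lambda>t. Re (?k t))" by (rule integrable_Re[OF int])
        fix t assume "t \<in> space \<mu>"
        then have t: "0 \<le> t" "t < 1" by (auto simp: sp)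
        \<comment> \<open>This is the value of \<open>1 - t z\<close> at the centre
          \<open>z = x\<close>; over the whole disk \<open>1 - t z\<close> stays within
          \<open>\<delta> / 4 \<le> r / 4\<close> of it.\<close>
        define r where "r = 1 - t * x"
        have "t * x \<le> 1 * x" using t x by (intro mult_right_mono) auto
        then have r: "\<delta> \<le> r" by (simp add: r_def \<delta>_def)
        have "(1 - of_real t * z) - of_real r = of_real t * (of_real x - z)"
          by (simp add: r_def algebra_simps)
        also have "norm \<dots> = t * norm (z - of_real x)"
          using t by (simp add: norm_mult norm_minus_commute)
        also have "\<dots> \<le> 1 * (\<delta> / 4)"
          using t B(1)[OF z] by (intro mult_mono) auto
        finally have "norm ((1 - of_real t * z) - of_real r) \<le> r / 4" using r by simp
        then have Re_ge: "1 / (5 * r\<^sup>2) \<le> Re (1 / (1 - of_real t * z)\<^sup>2)"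
          using r \<delta> by (intro Re_inverse_square_ge) auto
        have k: "Re (?k t) = t * Re (1 / (1 - of_real t * z)\<^sup>2)"
          using t B(2)[OF z]
          by (subst deriv_h[OF tz_le]) (simp_all only: times_complex.sel Re_complex_of_real
              Im_complex_of_real mult_zero_left diff_zero atLeastLessThan_iff simp_thms)
        have k_ge: "t * (1 / (5 * r\<^sup>2)) \<le> Re (?k t)"
          unfolding k using Re_ge t by (intro mult_left_mono) auto
        show "1 / (40 * \<delta>\<^sup>2) * indicator {x..<1} t \<le> Re (?k t)"
        proof (cases "x \<le> t")
          case True
          have "x * x \<le> t * x" using True x by (intro mult_right_mono) auto
          moreover have "(1 + x) * \<delta> \<le> 2 * \<delta>" using x \<delta> by (intro mult_right_mono) auto
          ultimately have "r \<le> 2 * \<delta>" by (simp add: r_def \<delta>_def algebra_simps)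
          then have "r\<^sup>2 \<le> (2 * \<delta>)\<^sup>2" using r \<delta> by (intro power_mono) auto
          then have "1 / (20 * \<delta>\<^sup>2) \<le> 1 / (5 * r\<^sup>2)"
            using r \<delta> by (intro divide_left_mono) (auto simp: power2_eq_square)
          then have "(1 / 2) * (1 / (20 * \<delta>\<^sup>2)) \<le> t * (1 / (5 * r\<^sup>2))"
            using True x by (intro mult_mono) auto
          then show ?thesis using True t k_ge by simp
        next
          case False
          have "0 \<le> t * (1 / (5 * r\<^sup>2))" using t by simp
          then show ?thesis using False k_ge by simp
        qed
      qed
      also have "\<dots> = Re (deriv ?g z)"
        using integral_Re[OF int] cesaro_like_deriv(3)[OF \<mu> _ zD, of "\<lambda>_. 1"] by simp
      also have "\<dots> \<le> norm (deriv ?g z)" by (rule complex_Re_le_cmod)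
      finally show ?thesis .
    qed
    \<comment> \<open>The pseudohyperbolic distance from \<open>x\<close> to \<open>z\<close> is at
      most \<open>(\<delta> / 4) / \<delta> = 1/4\<close>, and
      \<open>1 - 1/16 \<ge> 1/2\<close>.\<close>
    have weight_ge: "(1/2) powr p \<le> (1 - (cmod (disk_involution (of_real x) z))\<^sup>2) powr p"
      if z: "z \<in> ?B" for z
    proof -
      have d: "\<delta> \<le> norm (1 - of_real x * z)"
        unfolding \<delta>_def using x B(2)[OF z]
        by (intro order_trans[OF norm_one_minus_mult_bounds(1,3)]) simp_all
      have "cmod (disk_involution (of_real x) z) = norm (z - of_real x) / norm (1 - of_real x * z)"
        by (simp add: disk_involution_def norm_divide norm_minus_commute)
      also have "\<dots> \<le> (\<delta> / 4) / \<delta>"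
        using d \<delta> B(1)[OF z] by (intro frac_le) auto
      finally have "cmod (disk_involution (of_real x) z) \<le> 1/4" using \<delta> by simp
      then have "(cmod (disk_involution (of_real x) z))\<^sup>2 \<le> (1/4)\<^sup>2"
        by (intro power_mono) auto
      then show ?thesis using \<open>p > 0\<close> by (intro powr_mono2) (auto simp: power2_eq_square)
    qed
    let ?c = "(m / (40 * \<delta>\<^sup>2))\<^sup>2 * (1/2) powr p"
    have "ennreal (?c * (\<delta> / 4)\<^sup>2) = ennreal ?c * emeasure area_measure ?B"
      using \<delta> by (simp add: emeasure_area_measure_ball ennreal_mult)
    also have "\<dots> = (\<integral>\<^sup>+z. ennreal ?c * indicator ?B z \<partial>area_measure)"
      by (simp add: nn_integral_cmult_indicator)
    also have "\<dots> \<le> (\<integral>\<^sup>+z\<in>\<bbbD>. ennreal ((cmod (deriv ?g z))\<^sup>2 *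
        (1 - (cmod (disk_involution (of_real x) z))\<^sup>2) powr p) \<partial>area_measure)"
    proof (intro nn_integral_mono)
      fix z :: complex
      show "ennreal ?c * indicator ?B z \<le> ennreal ((cmod (deriv ?g z))\<^sup>2 *
        (1 - (cmod (disk_involution (of_real x) z))\<^sup>2) powr p) * indicator \<bbbD> z"
      proof (cases "z \<in> ?B")
        case True
        have "?c \<le> (cmod (deriv ?g z))\<^sup>2 * (1 - (cmod (disk_involution (of_real x) z))\<^sup>2) powr p"
          using deriv_ge[OF True] weight_ge[OF True] \<delta>
          by (intro mult_mono power_mono) (auto simp: m_def)
        then show ?thesis using True B(2)[OF True] by (simp add: ennreal_leI)
      qed simp
    qed
    also have "\<dots> \<le> Q_seminorm_sq p ?g"
      unfolding Q_seminorm_sq_def using x by (intro SUP_upper) auto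
    finally have "?c * (\<delta> / 4)\<^sup>2 \<le> S"
      using S by (simp add: ennreal_le_iff)
    then have "m\<^sup>2 \<le> 25600 * 2 powr p * S * \<delta>\<^sup>2"
      using \<delta> by (simp add: power2_eq_square powr_divide field_simps)
    then have "sqrt (m\<^sup>2) \<le> sqrt (25600 * 2 powr p * S * \<delta>\<^sup>2)" by (rule real_sqrt_le_mono)
    then show ?thesis using \<delta> by (simp add: real_sqrt_mult m_def \<delta>_def)
  qed
  \<comment> \<open>Twice the total mass covers \<open>x < 1/2\<close>, where
    \<open>1 - x > 1/2\<close>; the final 1 makes \<open>C\<close> strictly positive.\<close>
  define C where "C = sqrt (25600 * 2 powr p * S) + 2 * measure \<mu> (space \<mu>) + 1"
  have "C > 0" unfolding C_def using S by (intro add_nonneg_pos add_nonneg_nonneg) auto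
  moreover have "measure \<mu> {x..<1} \<le> C * (1 - x)" if x: "x \<in> {0..<1}" for x
  proof (cases "1/2 \<le> x")
    case True
    have "sqrt (25600 * 2 powr p * S) * (1 - x) \<le> C * (1 - x)"
      using x by (intro mult_right_mono) (auto simp: C_def)
    then show ?thesis using x by (intro order_trans[OF bound[OF True]]) auto
  next
    case False
    have "measure \<mu> {x..<1} \<le> measure \<mu> (space \<mu>)" by (rule bounded_measure)
    also have "\<dots> = 2 * measure \<mu> (space \<mu>) * (1/2)" by simp
    also have "\<dots> \<le> C * (1 - x)"
      using False S by (intro mult_mono) (auto simp: C_def)
    finally show ?thesis .
  qed
  ultimately show ?thesis unfolding carleson_measure_on_unit_interval_def by blast
qed

section \<open>The disk integral\<close>

text \<open>The factor \<open>1\<close> and the real exponent match the growth hypothesis of the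
  shell lemmas, with \<open>C = 1\<close> and \<open>m = 2\<close>.\<close>

lemma area_measure_growth:
  assumes "s > 0"
  shows "emeasure area_measure {z \<in> space area_measure. norm (z - v) < s} \<le> ennreal (1 * s powr 2)"
  using emeasure_area_measure_ball[of s v] assms
  by (simp add: ball_def dist_norm norm_minus_commute)

text \<open>Disks of equal radius have equal area, so one constant serves all centres
  \<open>v\<close> and radii \<open>R\<close>.\<close>

lemma area_measure_powr_inside:
  fixes a :: real
  assumes "0 \<le> a" "a < 2"
  obtains C where "C \<ge> 0"
    "\<And>v R. R > 0 \<Longrightarrow> (\<integral>\<^sup>+z. ennreal (norm (z - v) powr - a) * indicator {z. norm (z - v) < R} z \<partial>area_measure)
      \<le> ennreal (C * R powr (2 - a))"
proof
  show "0 \<le> 1 * 2 powr a / (1 - 2 powr (a - 2))"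
    using assms powr_less_one[of 2 "a - 2"] by simp
  fix v :: complex and R :: real assume "R > 0"
  show "(\<integral>\<^sup>+z. ennreal (norm (z - v) powr - a) * indicator {z. norm (z - v) < R} z \<partial>area_measure)
      \<le> ennreal (1 * 2 powr a / (1 - 2 powr (a - 2)) * R powr (2 - a))"
    using assms \<open>R > 0\<close> by (intro nn_integral_powr_inside area_measure_growth) (auto simp: measurable_cong_sets[OF sets_area_measure refl])
qed

lemma area_measure_powr_outside:
  fixes a :: real
  assumes "2 < a"
  obtains C where "C \<ge> 0"
    "\<And>v R. R > 0 \<Longrightarrow> (\<integral>\<^sup>+z. ennreal (norm (z - v) powr - a) * indicator {z. R \<le> norm (z - v)} z \<partial>area_measure)
      \<le> ennreal (C * R powr (2 - a))"
proof
  show "0 \<le> 1 * 2 powr 2 / (1 - 2 powr (2 - a))"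
    using assms powr_less_one[of 2 "2 - a"] by simp
  fix v :: complex and R :: real assume "R > 0"
  show "(\<integral>\<^sup>+z. ennreal (norm (z - v) powr - a) * indicator {z. R \<le> norm (z - v)} z \<partial>area_measure)
      \<le> ennreal (1 * 2 powr 2 / (1 - 2 powr (2 - a)) * R powr (2 - a))"
    using assms \<open>R > 0\<close> by (intro nn_integral_powr_outside area_measure_growth) (auto simp: measurable_cong_sets[OF sets_area_measure refl])
qed

text \<open>Expanding squares gives
  \<open>|1 - cnj w z|^2 - |w - z|^2 = (1 - |w|^2) (1 - |z|^2)\<close>; it remains to divide by the
  first term.\<close>

lemma one_minus_norm_disk_involution_sq:
  assumes "w \<in> \<bbbD>" "z \<in> \<bbbD>"
  shows "1 - (cmod (disk_involution w z))\<^sup>2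
    = (1 - (norm w)\<^sup>2) * (1 - (norm z)\<^sup>2) / (norm (1 - cnj w * z))\<^sup>2"
proof -
  have "norm w * norm z < 1"
    using mult_strict_mono[of "norm w" 1 "norm z" 1] assms by simp
  then have "norm (cnj w * z) < 1" by (simp add: norm_mult)
  then have nz: "1 - cnj w * z \<noteq> 0" by auto
  have "(norm (1 - cnj w * z))\<^sup>2 - (norm (w - z))\<^sup>2 = (1 - (norm w)\<^sup>2) * (1 - (norm z)\<^sup>2)"
    unfolding cmod_power2 by (simp add: power2_eq_square algebra_simps)
  then show ?thesis
    using nz by (simp add: disk_involution_def norm_divide power_divide field_simps)
qed

text \<open>
  Here \<open>A = 1 - |z|\<close>, \<open>D = 1 - |w|\<close>, \<open>x = |1 - z|\<close>, \<open>d = |1 - w|\<close>, \<open>y = |1 - cnj w z|\<close> and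
  \<open>s = |z - w|\<close>. Each of the three bounds on the right has an area integral over its region that
  is scale invariant, hence independent of \<open>d\<close>.
\<close>

lemma disk_kernel_pointwise:
  fixes A D x d y s p :: real
  assumes p: "0 < p" "p < 2" and pos: "0 < A" "0 < D" "0 < s"
    and le: "A \<le> x" "D \<le> d" "A \<le> y" "D \<le> y" "s \<le> y"
    and far: "4 * d \<le> x \<Longrightarrow> x \<le> 4 * y" and near: "4 * x \<le> d \<Longrightarrow> d \<le> 4 * y"
  shows "A powr (p/2) * x powr (p/2 - 2) * D powr p * y powr (- 2 * p)
    \<le> (if 4 * d \<le> x then 16 powr p * d powr p * x powr - (p + 2)
       else if 4 * x \<le> d then 16 powr p * d powr - p * x powr - (2 - p)
       else (d / 4) powr (p/2 - 2) * s powr - (p/2))"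
proof -
  \<comment> \<open>The bound \<open>y_powr\<close> below replaces \<open>y\<close> by whichever of
    \<open>x\<close> and \<open>d\<close> is the larger in the far and near regions; its constant is
    \<open>4 powr (2 * p) = 16 powr p\<close>.\<close>
  have pos': "x > 0" "y > 0" "d > 0" using pos le by auto
  have y_powr: "y powr (- 2 * p) \<le> 16 powr p * c powr (- 2 * p)" if "c \<le> 4 * y" "c > 0" for c
  proof -
    have "y powr (- 2 * p) \<le> (c / 4) powr (- 2 * p)"
      using that p by (intro powr_mono2') auto
    also have "\<dots> = 4 powr (2 * p) * c powr (- 2 * p)"
      using that by (simp add: powr_divide powr_minus field_simps)
    also have "4 powr (2 * p) = 16 powr p" using powr_powr[of 4 2 p] by simp
    finally show ?thesis .
  qed
  have Ax: "A powr (p/2) \<le> x powr (p/2)" and Dd: "D powr p \<le> d powr p"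
    using pos le p by (auto intro!: powr_mono2)
  consider "4 * d \<le> x" | "\<not> 4 * d \<le> x" "4 * x \<le> d" | "\<not> 4 * d \<le> x" "\<not> 4 * x \<le> d" by blast
  then show ?thesis
  proof cases
    case 1
    have "A powr (p/2) * x powr (p/2 - 2) * D powr p * y powr (- 2 * p)
      \<le> x powr (p/2) * x powr (p/2 - 2) * d powr p * (16 powr p * x powr (- 2 * p))"
      using y_powr[of x] far 1 pos' Ax Dd by (intro mult_mono) auto
    also have "\<dots> = 16 powr p * d powr p * (x powr (p/2) * x powr (p/2 - 2) * x powr (- 2 * p))"
      by (simp add: mult_ac)
    also have "x powr (p/2) * x powr (p/2 - 2) * x powr (- 2 * p) = x powr (p/2 + (p/2 - 2) + - 2 * p)"
      by (simp only: powr_add)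
    also have "p/2 + (p/2 - 2) + - 2 * p = - (p + 2)" by (simp add: field_simps)
    finally show ?thesis using 1 by simp
  next
    case 2
    have "A powr (p/2) * x powr (p/2 - 2) * D powr p * y powr (- 2 * p)
      \<le> x powr (p/2) * x powr (p/2 - 2) * d powr p * (16 powr p * d powr (- 2 * p))"
      using y_powr[of d] near 2 pos' Ax Dd by (intro mult_mono) auto
    also have "\<dots> = 16 powr p * (d powr p * d powr (- 2 * p)) * (x powr (p/2) * x powr (p/2 - 2))"
      by (simp add: mult_ac)
    also have "d powr p * d powr (- 2 * p) = d powr (p + - 2 * p)" by (simp only: powr_add)
    also have "p + - 2 * p = - p" by simp
    also have "x powr (p/2) * x powr (p/2 - 2) = x powr (p/2 + (p/2 - 2))" by (simp only: powr_add)
    also have "p/2 + (p/2 - 2) = - (2 - p)" by simp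
    finally show ?thesis using 2 by simp
  next
    case 3
    have "x powr (p/2 - 2) \<le> (d / 4) powr (p/2 - 2)"
      using 3 pos' p by (intro powr_mono2') auto
    \<comment> \<open>Where \<open>x\<close> and \<open>d\<close> are comparable, \<open>A\<close>
      and \<open>D\<close> are both traded for \<open>y\<close>; the exponents add up to
      \<open>- (p/2)\<close>, and only then is \<open>y\<close> replaced by
      \<open>s\<close>.\<close>
    moreover have "A powr (p/2) * D powr p * y powr (- 2 * p) \<le> s powr - (p/2)"
    proof -
      have "A powr (p/2) \<le> y powr (p/2)" "D powr p \<le> y powr p"
        using pos le p by (auto intro!: powr_mono2)
      then have "A powr (p/2) * D powr p * y powr (- 2 * p) \<le> y powr (p/2) * y powr p * y powr (- 2 * p)"
        by (intro mult_mono) auto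
      also have "\<dots> = y powr (p/2 + p + - 2 * p)" by (simp only: powr_add)
      also have "p/2 + p + - 2 * p = - (p/2)" by simp
      also have "y powr - (p/2) \<le> s powr - (p/2)"
        using pos le p by (intro powr_mono2') auto
      finally show ?thesis .
    qed
    ultimately have "x powr (p/2 - 2) * (A powr (p/2) * D powr p * y powr (- 2 * p))
        \<le> (d / 4) powr (p/2 - 2) * s powr - (p/2)"
      by (intro mult_mono) auto
    then show ?thesis using 3 by (simp add: mult_ac)
  qed
qed

text \<open>The identity for the involution gives \<open>W \<le> 4 * A * D / y\<^sup>2\<close>,
  which leaves the expression estimated in \<open>disk_kernel_pointwise\<close>. Three indicator
  terms replace the case distinction so that each can be integrated alone. Excluding
  \<open>z = w\<close> keeps \<open>s\<close> positive.\<close>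

lemma disk_kernel_bound:
  fixes w z :: complex and p :: real
  assumes p: "0 < p" "p < 2" and w: "w \<in> \<bbbD>" and z: "z \<in> \<bbbD>" and "z \<noteq> w"
  defines "d \<equiv> norm (1 - w)"
  shows "(1 - norm z) powr - (p/2) * norm (1 - z) powr (p/2 - 2) *
      (1 - (cmod (disk_involution w z))\<^sup>2) powr p
    \<le> 64 powr p * d powr p * (norm (z - 1) powr - (p + 2) * indicator {z. 4 * d \<le> norm (z - 1)} z)
      + 64 powr p * d powr - p * (norm (z - 1) powr - (2 - p) * indicator {z. norm (z - 1) < d} z)
      + 4 powr p * (d / 4) powr (p/2 - 2) * (norm (z - w) powr - (p/2) * indicator {z. norm (z - w) < 5 * d} z)"
proof -
  define A D x y s where "A = 1 - norm z" and "D = 1 - norm w" and "x = norm (z - 1)"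
    and "y = norm (1 - cnj w * z)" and "s = norm (z - w)"
  have nwz: "norm w < 1" "norm z < 1" using w z by auto
  have pos: "0 < A" "0 < D" "0 < s" using nwz \<open>z \<noteq> w\<close> by (auto simp: A_def D_def s_def)
  have Ax: "A \<le> x" and Dd: "D \<le> d"
    using norm_triangle_ineq2[of 1 z] norm_triangle_ineq2[of 1 w]
    by (auto simp: A_def x_def D_def d_def norm_minus_commute)
  have y_ge: "1 - norm w * norm z \<le> y"
    using norm_triangle_ineq2[of 1 "cnj w * z"] by (simp add: y_def norm_mult)
  have "norm w * norm z \<le> 1 * norm z" "norm w * norm z \<le> norm w * 1"
    using nwz by (intro mult_mono; simp)+
  then have Ay: "A \<le> y" and Dy: "D \<le> y" using y_ge by (auto simp: A_def D_def)
  then have y0: "y > 0" using pos by simp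
  define W where "W = 1 - (cmod (disk_involution w z))\<^sup>2"
  have W_eq: "W = (1 - (norm w)\<^sup>2) * (1 - (norm z)\<^sup>2) / y\<^sup>2"
    unfolding W_def y_def by (rule one_minus_norm_disk_involution_sq[OF w z])
  have one_minus_sq: "0 \<le> 1 - (norm u)\<^sup>2" "1 - (norm u)\<^sup>2 \<le> 2 * (1 - norm u)"
    if "norm u < 1" for u :: complex
  proof -
    have "1 - (norm u)\<^sup>2 = (1 + norm u) * (1 - norm u)" by (simp add: power2_eq_square algebra_simps)
    moreover have "(1 + norm u) * (1 - norm u) \<le> 2 * (1 - norm u)"
      using that by (intro mult_right_mono) auto
    ultimately show "0 \<le> 1 - (norm u)\<^sup>2" "1 - (norm u)\<^sup>2 \<le> 2 * (1 - norm u)"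
      using that by auto
  qed
  have W0: "0 \<le> W"
    unfolding W_eq using one_minus_sq(1) nwz by (intro divide_nonneg_nonneg mult_nonneg_nonneg) auto
  have "(1 - (norm w)\<^sup>2) * (1 - (norm z)\<^sup>2) \<le> (2 * D) * (2 * A)"
    unfolding A_def D_def using one_minus_sq nwz by (intro mult_mono) auto
  then have W_le: "W \<le> 4 * A * D / y\<^sup>2"
    unfolding W_eq using y0 by (intro divide_right_mono) (auto simp: mult_ac)
  \<comment> \<open>This is \<open>|disk_involution w z| \<le> 1\<close>, read off from
    \<open>W \<ge> 0\<close>.\<close>
  have "s\<^sup>2 \<le> y\<^sup>2"
  proof -
    have "s\<^sup>2 / y\<^sup>2 \<le> 1"
      using W0 unfolding W_def disk_involution_def s_def y_def
      by (simp add: norm_divide power_divide norm_minus_commute)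
    then show ?thesis using y0 by simp
  qed
  then have sy: "s \<le> y" using y0 by (simp add: power2_le_iff_abs_le s_def)
  \<comment> \<open>Since \<open>x \<le> 2\<close>, the point \<open>w\<close> is within 1/2 of 1,
    so \<open>norm w \<ge> 1/2\<close>. Then
    \<open>x / 2 \<le> d + y \<le> x / 4 + y\<close>.\<close>
  have far: "x \<le> 4 * y" if "4 * d \<le> x"
  proof -
    have x2: "x \<le> 2" using norm_triangle_ineq4[of z 1] nwz by (simp add: x_def)
    have wh: "norm w \<ge> 1/2" using Dd that x2 by (simp add: D_def)
    have "cnj w * (z - 1) = cnj (1 - w) - (1 - cnj w * z)"
      by (simp add: algebra_simps)
    then have "norm (cnj w * (z - 1)) \<le> norm (cnj (1 - w)) + y"
      unfolding y_def by (metis norm_triangle_ineq4)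
    then have "norm w * x \<le> d + y" by (simp add: norm_mult x_def d_def flip: complex_cnj_diff)
    moreover have "1/2 * x \<le> norm w * x" using wh by (intro mult_right_mono) (auto simp: x_def)
    ultimately show ?thesis using that by simp
  qed
  \<comment> \<open>The same argument with \<open>z\<close> and \<open>w\<close> exchanged.\<close>
  have near: "d \<le> 4 * y" if "4 * x \<le> d"
  proof -
    have d2: "d \<le> 2" using norm_triangle_ineq4[of 1 w] nwz by (simp add: d_def)
    have zh: "norm z \<ge> 1/2" using Ax that d2 by (simp add: A_def)
    have "z * cnj (1 - w) = (z - 1) + (1 - cnj w * z)"
      by (simp add: algebra_simps)
    then have "norm (z * cnj (1 - w)) \<le> x + y"
      unfolding y_def x_def by (metis norm_triangle_ineq)
    then have "norm z * d \<le> x + y" by (simp add: norm_mult d_def flip: complex_cnj_diff)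
    moreover have "1/2 * d \<le> norm z * d" using zh by (intro mult_right_mono) (auto simp: d_def)
    ultimately show ?thesis using that by simp
  qed
  have sxd: "s \<le> x + d"
    using norm_triangle_ineq[of "z - 1" "1 - w"] by (simp add: s_def x_def d_def)
  have "A powr - (p/2) * x powr (p/2 - 2) * W powr p
      \<le> A powr - (p/2) * x powr (p/2 - 2) * (4 * A * D / y\<^sup>2) powr p"
    using W0 W_le p by (intro mult_left_mono powr_mono2) auto
  also have "(4 * A * D / y\<^sup>2) powr p = 4 powr p * A powr p * D powr p * y powr (- 2 * p)"
  proof -
    have "(y\<^sup>2) powr p = y powr (2 * p)"
      using y0 by (simp add: powr_powr flip: powr_numeral)
    then show ?thesis using pos y0
      by (simp add: powr_divide powr_mult powr_minus field_simps)
  qed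
  also have "A powr - (p/2) * x powr (p/2 - 2) * (4 powr p * A powr p * D powr p * y powr (- 2 * p))
      = 4 powr p * ((A powr - (p/2) * A powr p) * x powr (p/2 - 2) * D powr p * y powr (- 2 * p))"
    by (simp add: mult_ac)
  also have "A powr - (p/2) * A powr p = A powr (- (p/2) + p)" by (simp only: powr_add)
  also have "- (p/2) + p = p/2" by simp
  also have "4 powr p * (A powr (p/2) * x powr (p/2 - 2) * D powr p * y powr (- 2 * p))
      \<le> 4 powr p * (if 4 * d \<le> x then 16 powr p * d powr p * x powr - (p + 2)
       else if 4 * x \<le> d then 16 powr p * d powr - p * x powr - (2 - p)
       else (d / 4) powr (p/2 - 2) * s powr - (p/2))"
    using disk_kernel_pointwise[OF p pos Ax Dd Ay Dy sy far near] by (intro mult_left_mono) auto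
  \<comment> \<open>The regions are enlarged to disks: \<open>4 * x \<le> d\<close> gives
    \<open>x < d\<close>, and in the comparable case \<open>s \<le> x + d < 5 * d\<close>.\<close>
  also have "\<dots> \<le> 64 powr p * d powr p * (x powr - (p + 2) * indicator {z. 4 * d \<le> norm (z - 1)} z)
      + 64 powr p * d powr - p * (x powr - (2 - p) * indicator {z. norm (z - 1) < d} z)
      + 4 powr p * (d / 4) powr (p/2 - 2) * (s powr - (p/2) * indicator {z. norm (z - w) < 5 * d} z)"
    (is "_ \<le> ?T1 + ?T2 + ?T3")
  proof -
    have nn: "?T1 \<ge> 0" "?T2 \<ge> 0" "?T3 \<ge> 0" by auto
    have e64: "64 powr p = 4 powr p * 16 powr p" by (simp flip: powr_mult)
    consider "4 * d \<le> x" | "\<not> 4 * d \<le> x" "4 * x \<le> d" | "\<not> 4 * d \<le> x" "\<not> 4 * x \<le> d" by blast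
    then show ?thesis
    proof cases
      case 1
      then show ?thesis using nn(2,3) by (simp add: x_def e64 mult_ac)
    next
      case 2
      have "x < d" using 2(2) pos Ax by auto
      then show ?thesis using 2 nn(1,3) by (simp add: x_def e64 mult_ac)
    next
      case 3
      have "s < 5 * d" using 3 sxd by simp
      then show ?thesis using 3 nn(1,2) by (simp add: s_def mult_ac)
    qed
  qed
  finally show ?thesis
    by (simp only: A_def x_def s_def W_def norm_minus_commute[of 1 z])
qed

text \<open>Each of the three majorants integrates to a power of \<open>d\<close> that its
  coefficient cancels exactly, hence the uniformity in \<open>w\<close>. The singularities have
  exponents \<open>p + 2 > 2\<close> outside a disk and \<open>2 - p < 2\<close>,
  \<open>p/2 < 2\<close> inside one.\<close>

lemma disk_kernel_integral_bounded:
  fixes p :: real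
  assumes p: "0 < p" "p < 2"
  obtains K where "K \<ge> 0"
    "\<And>w. w \<in> \<bbbD> \<Longrightarrow> (\<integral>\<^sup>+z\<in>\<bbbD>. ennreal ((1 - norm z) powr - (p/2) * norm (1 - z) powr (p/2 - 2) *
      (1 - (cmod (disk_involution w z))\<^sup>2) powr p) \<partial>area_measure) \<le> ennreal K"
proof -
  obtain C1 where C1: "C1 \<ge> 0" "\<And>v R. R > 0 \<Longrightarrow>
      (\<integral>\<^sup>+z. ennreal (norm (z - v) powr - (p + 2)) * indicator {z. R \<le> norm (z - v)} z \<partial>area_measure)
      \<le> ennreal (C1 * R powr (2 - (p + 2)))"
    using area_measure_powr_outside[of "p + 2"] p by auto
  obtain C2 where C2: "C2 \<ge> 0" "\<And>v R. R > 0 \<Longrightarrow>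
      (\<integral>\<^sup>+z. ennreal (norm (z - v) powr - (2 - p)) * indicator {z. norm (z - v) < R} z \<partial>area_measure)
      \<le> ennreal (C2 * R powr (2 - (2 - p)))"
    using area_measure_powr_inside[of "2 - p"] p by auto
  obtain C3 where C3: "C3 \<ge> 0" "\<And>v R. R > 0 \<Longrightarrow>
      (\<integral>\<^sup>+z. ennreal (norm (z - v) powr - (p/2)) * indicator {z. norm (z - v) < R} z \<partial>area_measure)
      \<le> ennreal (C3 * R powr (2 - p/2))"
    using area_measure_powr_inside[of "p/2"] p by auto
  \<comment> \<open>The factor \<open>4 powr - p\<close> comes from the radius \<open>4 * d\<close>,
    and 20 = 4 * 5 from \<open>d / 4\<close> against the radius \<open>5 * d\<close>.\<close>
  define K where "K = 64 powr p * 4 powr - p * C1 + 64 powr p * C2 + 4 powr p * 20 powr (2 - p/2) * C3"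
  have "K \<ge> 0" using C1(1) C2(1) C3(1) by (simp add: K_def)
  moreover have "(\<integral>\<^sup>+z\<in>\<bbbD>. ennreal ((1 - norm z) powr - (p/2) * norm (1 - z) powr (p/2 - 2) *
      (1 - (cmod (disk_involution w z))\<^sup>2) powr p) \<partial>area_measure) \<le> ennreal K" if w: "w \<in> \<bbbD>" for w
  proof -
    define d where "d = norm (1 - w)"
    have "w \<noteq> 1" using w by auto
    then have d: "d > 0" by (simp add: d_def)
    let ?a1 = "64 powr p * d powr p" and ?a2 = "64 powr p * d powr - p"
      and ?a3 = "4 powr p * (d / 4) powr (p/2 - 2)"
    let ?f1 = "\<lambda>z::complex. ennreal (norm (z - 1) powr - (p + 2)) * indicator {z. 4 * d \<le> norm (z - 1)} z"
      and ?f2 = "\<lambda>z::complex. ennreal (norm (z - 1) powr - (2 - p)) * indicator {z. norm (z - 1) < d} z"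
      and ?f3 = "\<lambda>z::complex. ennreal (norm (z - w) powr - (p/2)) * indicator {z. norm (z - w) < 5 * d} z"
    \<comment> \<open>At \<open>z = w\<close> the majorant degenerates, since \<open>0 powr - (p/2) = 0\<close>.\<close>
    have "emeasure area_measure {w} = 0"
      by (simp add: area_measure_def)
    then have "AE z in area_measure. z \<noteq> w"
      by (intro AE_I[where N = "{w}"]) auto
    then have "(\<integral>\<^sup>+z\<in>\<bbbD>. ennreal ((1 - norm z) powr - (p/2) * norm (1 - z) powr (p/2 - 2) *
        (1 - (cmod (disk_involution w z))\<^sup>2) powr p) \<partial>area_measure)
      \<le> (\<integral>\<^sup>+z. ennreal ?a1 * ?f1 z + ennreal ?a2 * ?f2 z + ennreal ?a3 * ?f3 z \<partial>area_measure)"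
    proof (intro nn_integral_mono_AE, eventually_elim)
      fix z assume "z \<noteq> w"
      show "ennreal ((1 - norm z) powr - (p/2) * norm (1 - z) powr (p/2 - 2) *
        (1 - (cmod (disk_involution w z))\<^sup>2) powr p) * indicator \<bbbD> z
        \<le> ennreal ?a1 * ?f1 z + ennreal ?a2 * ?f2 z + ennreal ?a3 * ?f3 z"
      proof (cases "z \<in> \<bbbD>")
        case True
        have ind: "ennreal u * indicator X z = ennreal (u * indicator X z)" for u and X :: "complex set"
          by (simp add: indicator_def)
        show ?thesis
          using disk_kernel_bound[OF p w True \<open>z \<noteq> w\<close>] True
          by (simp add: ind d_def ennreal_leI flip: ennreal_mult ennreal_plus)
      qed simp
    qed
    also have "\<dots> = ennreal ?a1 * (\<integral>\<^sup>+z. ?f1 z \<partial>area_measure)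
        + ennreal ?a2 * (\<integral>\<^sup>+z. ?f2 z \<partial>area_measure) + ennreal ?a3 * (\<integral>\<^sup>+z. ?f3 z \<partial>area_measure)"
      by (simp add: nn_integral_add nn_integral_cmult)
    also have "\<dots> \<le> ennreal ?a1 * ennreal (C1 * (4 * d) powr (2 - (p + 2)))
        + ennreal ?a2 * ennreal (C2 * d powr (2 - (2 - p)))
        + ennreal ?a3 * ennreal (C3 * (5 * d) powr (2 - p/2))"
      using d C1(2)[of "4 * d" 1] C2(2)[of d 1] C3(2)[of "5 * d" w]
      by (intro add_mono mult_left_mono) auto
    also have "\<dots> = ennreal (?a1 * (C1 * (4 * d) powr (2 - (p + 2)))
        + ?a2 * (C2 * d powr (2 - (2 - p))) + ?a3 * (C3 * (5 * d) powr (2 - p/2)))"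
      using C1(1) C2(1) C3(1) by (simp flip: ennreal_mult ennreal_plus)
    also have "\<dots> = ennreal K"
    proof -
      have e1: "d powr p * (4 * d) powr (2 - (p + 2)) = 4 powr - p"
        using d by (simp add: powr_mult powr_minus)
      have e2: "d powr - p * d powr (2 - (2 - p)) = 1"
        using d by (simp add: powr_minus)
      have e3: "(d / 4) powr (p/2 - 2) * (5 * d) powr (2 - p/2) = 20 powr (2 - p/2)"
      proof -
        define e where "e = 2 - p/2"
        have "(d / 4) powr - e * (5 * d) powr e = 4 powr e * 5 powr e"
          using d by (simp add: powr_divide powr_minus powr_mult)
        also have "\<dots> = 20 powr e" by (simp flip: powr_mult)
        finally show ?thesis by (simp add: e_def)
      qed
      have "?a1 * (C1 * (4 * d) powr (2 - (p + 2))) + ?a2 * (C2 * d powr (2 - (2 - p)))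
          + ?a3 * (C3 * (5 * d) powr (2 - p/2))
        = 64 powr p * (d powr p * (4 * d) powr (2 - (p + 2))) * C1
          + 64 powr p * (d powr - p * d powr (2 - (2 - p))) * C2
          + 4 powr p * ((d / 4) powr (p/2 - 2) * (5 * d) powr (2 - p/2)) * C3"
        by (simp only: mult_ac)
      then show ?thesis unfolding e1 e2 e3 K_def by simp
    qed
    finally show ?thesis .
  qed
  ultimately show ?thesis using that by blast
qed

section \<open>Sufficiency of the Carleson condition\<close>

text \<open>The factor \<open>1 / (1 - t |z|)\<close> is split into powers \<open>\<epsilon>\<close>
  and \<open>1 - \<epsilon>\<close>, estimated through \<open>1 - |z|\<close> and
  \<open>1 - t\<close>. The other denominator is at least \<open>|1 - z| / 2\<close> and at least
  \<open>1 - t\<close>; the first is used for \<open>1 - t < |1 - z|\<close>, the second beyond.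
  Convergence needs \<open>\<epsilon> > 0\<close> in the inner range and
  \<open>\<epsilon> < 1\<close> in the outer one.\<close>

lemma carleson_kernel_bound:
  fixes \<mu> :: "real measure" and \<epsilon> :: real
  assumes \<mu>: "finite_borel_measure_on {0..<1} \<mu>" and "carleson_measure_on_unit_interval \<mu>"
    and \<epsilon>: "0 < \<epsilon>" "\<epsilon> < 1"
  obtains K where "K \<ge> 0"
    "\<And>z. z \<in> \<bbbD> \<Longrightarrow> (\<integral>\<^sup>+t. ennreal (1 / ((1 - t * norm z) * norm (1 - of_real t * z))) \<partial>\<mu>)
      \<le> ennreal (K * ((1 - norm z) powr - \<epsilon> * norm (1 - z) powr (\<epsilon> - 1)))"
proof -
  interpret finite_measure \<mu> using \<mu> by (rule finite_borel_measure_on_unit_intervalD)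
  note sp = finite_borel_measure_on_unit_intervalD(2)[OF \<mu>]
  obtain C where C: "C > 0" "\<And>t. t \<in> {0..<1} \<Longrightarrow> measure \<mu> {t..<1} \<le> C * (1 - t)"
    using assms(2) unfolding carleson_measure_on_unit_interval_def by blast
  have meas [measurable]: "(\<lambda>t. 1 - t) \<in> borel_measurable \<mu>"
    by (intro finite_borel_measure_on_unit_intervalD(3)[OF \<mu>]) measurable
  have growth: "emeasure \<mu> {t \<in> space \<mu>. 1 - t < s} \<le> ennreal (C * s powr 1)" if s: "s > 0" for s
  proof -
    \<comment> \<open>Truncation at 0 keeps \<open>r\<close> in the interval where the Carleson
      condition applies, also when \<open>s > 1\<close>.\<close>
    define r where "r = max 0 (1 - s)"
    have r: "r \<in> {0..<1}" "1 - r \<le> s" using s by (auto simp: r_def)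
    have "{r..<1} \<inter> {0..<1} = {r..<1}" using r by auto
    then have "{r..<1} \<in> sets \<mu>" using finite_borel_measure_on_unit_intervalD(4)[OF \<mu>, of r] by simp
    then have "measure \<mu> {t \<in> space \<mu>. 1 - t < s} \<le> measure \<mu> {r..<1}"
      by (intro finite_measure_mono) (auto simp: sp r_def)
    also have "\<dots> \<le> C * (1 - r)" by (rule C(2)[OF r(1)])
    also have "\<dots> \<le> C * s" using C(1) r(2) by (intro mult_left_mono) auto
    finally show ?thesis using s by (simp add: emeasure_eq_measure ennreal_leI)
  qed
  \<comment> \<open>These are the constants of the inside and outside shell lemmas with
    \<open>m = 1\<close> and exponents \<open>1 - \<epsilon>\<close> and
    \<open>2 - \<epsilon>\<close>, left unsimplified so that the lemmas match.\<close>
  define c1 c2 where "c1 = C * 2 powr (1 - \<epsilon>) / (1 - 2 powr ((1 - \<epsilon>) - 1))"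
    and "c2 = C * 2 powr 1 / (1 - 2 powr (1 - (2 - \<epsilon>)))"
  have C12: "c1 \<ge> 0" "c2 \<ge> 0"
    using C(1) \<epsilon> powr_less_one[of 2 "- \<epsilon>"] powr_less_one[of 2 "\<epsilon> - 1"] by (auto simp: c1_def c2_def)
  have "(\<integral>\<^sup>+t. ennreal (1 / ((1 - t * norm z) * norm (1 - of_real t * z))) \<partial>\<mu>)
      \<le> ennreal ((2 * c1 + c2) * ((1 - norm z) powr - \<epsilon> * norm (1 - z) powr (\<epsilon> - 1)))"
    if z: "z \<in> \<bbbD>" for z
  proof -
    define a b where "a = 1 - norm z" and "b = norm (1 - z)"
    have "z \<noteq> 1" using z by auto
    then have ab: "a > 0" "b > 0" using z by (auto simp: a_def b_def)
    let ?f1 = "\<lambda>t. ennreal ((1 - t) powr - (1 - \<epsilon>)) * indicator {t. 1 - t < b} t"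
      and ?f2 = "\<lambda>t. ennreal ((1 - t) powr - (2 - \<epsilon>)) * indicator {t. b \<le> 1 - t} t"
    have [measurable]: "?f1 \<in> borel_measurable \<mu>" "?f2 \<in> borel_measurable \<mu>"
      by (intro finite_borel_measure_on_unit_intervalD(3)[OF \<mu>]; measurable)+
    have "(\<integral>\<^sup>+t. ennreal (1 / ((1 - t * norm z) * norm (1 - of_real t * z))) \<partial>\<mu>)
        \<le> (\<integral>\<^sup>+t. ennreal (a powr - \<epsilon> * (2 / b)) * ?f1 t + ennreal (a powr - \<epsilon>) * ?f2 t \<partial>\<mu>)"
    proof (intro nn_integral_mono)
      fix t assume "t \<in> space \<mu>"
      then have t: "0 \<le> t" "t < 1" by (auto simp: sp)
      define s q v where "s = 1 - t" and "q = 1 - t * norm z" and "v = norm (1 - of_real t * z)"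
      have "norm z < 1" using z by simp
      note bd = norm_one_minus_mult_bounds[OF t this, folded s_def q_def v_def a_def b_def]
      have s: "s > 0" using t by (simp add: s_def)
      have q: "q > 0" "v > 0" using s bd by auto
      have "1 / q = q powr - \<epsilon> * q powr - (1 - \<epsilon>)"
        using q(1) powr_minus_divide[of q 1] by (simp flip: powr_add)
      also have "\<dots> \<le> a powr - \<epsilon> * s powr - (1 - \<epsilon>)"
      proof -
        have "q powr - \<epsilon> \<le> a powr - \<epsilon>" "q powr - (1 - \<epsilon>) \<le> s powr - (1 - \<epsilon>)"
          using ab s bd \<epsilon> by (auto intro!: powr_mono2')
        then show ?thesis by (intro mult_mono) auto
      qed
      finally have inv_q: "1 / q \<le> a powr - \<epsilon> * s powr - (1 - \<epsilon>)" .
      show "ennreal (1 / (q * v))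
        \<le> ennreal (a powr - \<epsilon> * (2 / b)) * ?f1 t + ennreal (a powr - \<epsilon>) * ?f2 t"
      proof (cases "s < b")
        case True
        have "1 / v \<le> 2 / b" using ab q bd(4) by (simp add: field_simps)
        then have "1 / q * (1 / v) \<le> a powr - \<epsilon> * s powr - (1 - \<epsilon>) * (2 / b)"
          using inv_q q by (intro mult_mono) auto
        then have "ennreal (1 / (q * v)) \<le> ennreal (a powr - \<epsilon> * (2 / b) * s powr - (1 - \<epsilon>))"
          by (intro ennreal_leI) (simp add: mult_ac)
        then show ?thesis using True ab by (simp add: s_def flip: ennreal_mult)
      next
        case False
        have "1 / v \<le> 1 / s" using s bd by (intro divide_left_mono) auto
        then have "1 / q * (1 / v) \<le> a powr - \<epsilon> * s powr - (1 - \<epsilon>) * (1 / s)"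
          using inv_q q by (intro mult_mono) auto
        also have "\<dots> = a powr - \<epsilon> * (s powr - (1 - \<epsilon>) * s powr - 1)"
          using s powr_minus_divide[of s 1] by simp
        also have "s powr - (1 - \<epsilon>) * s powr - 1 = s powr (- (1 - \<epsilon>) + - 1)"
          by (simp only: powr_add)
        also have "- (1 - \<epsilon>) + - 1 = - (2 - \<epsilon>)" by simp
        finally have "ennreal (1 / (q * v)) \<le> ennreal (a powr - \<epsilon> * s powr - (2 - \<epsilon>))"
          by (intro ennreal_leI) simp
        then show ?thesis using False by (simp add: s_def flip: ennreal_mult)
      qed
    qed
    also have "\<dots> = ennreal (a powr - \<epsilon> * (2 / b)) * (\<integral>\<^sup>+t. ?f1 t \<partial>\<mu>)
        + ennreal (a powr - \<epsilon>) * (\<integral>\<^sup>+t. ?f2 t \<partial>\<mu>)"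
      by (subst nn_integral_add) (auto simp: nn_integral_cmult)
    also have "\<dots> \<le> ennreal (a powr - \<epsilon> * (2 / b)) * ennreal (c1 * b powr (1 - (1 - \<epsilon>)))
        + ennreal (a powr - \<epsilon>) * ennreal (c2 * b powr (1 - (2 - \<epsilon>)))"
    proof (intro add_mono mult_left_mono)
      show "(\<integral>\<^sup>+t. ?f1 t \<partial>\<mu>) \<le> ennreal (c1 * b powr (1 - (1 - \<epsilon>)))"
        unfolding c1_def c2_def using meas growth C(1) ab \<epsilon> by (intro nn_integral_powr_inside) (auto simp: sp)
      show "(\<integral>\<^sup>+t. ?f2 t \<partial>\<mu>) \<le> ennreal (c2 * b powr (1 - (2 - \<epsilon>)))"
        unfolding c1_def c2_def using meas growth C(1) ab \<epsilon> by (intro nn_integral_powr_outside) auto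
    qed auto
    also have "\<dots> = ennreal (a powr - \<epsilon> * (2 / b) * (c1 * b powr (1 - (1 - \<epsilon>)))
        + a powr - \<epsilon> * (c2 * b powr (1 - (2 - \<epsilon>))))"
      using C12 ab by (simp flip: ennreal_mult ennreal_plus)
    also have "a powr - \<epsilon> * (2 / b) * (c1 * b powr (1 - (1 - \<epsilon>)))
        + a powr - \<epsilon> * (c2 * b powr (1 - (2 - \<epsilon>)))
      = (2 * c1 + c2) * (a powr - \<epsilon> * b powr (\<epsilon> - 1))"
    proof -
      have "b powr (1 - (1 - \<epsilon>)) = b * b powr (\<epsilon> - 1)"
        using ab by (simp add: powr_diff)
      moreover have "1 - (2 - \<epsilon>) = \<epsilon> - 1" by simp
      moreover have "a powr - \<epsilon> * (2 / b) * (c1 * (b * y)) + a powr - \<epsilon> * (c2 * y)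
          = (2 * c1 + c2) * (a powr - \<epsilon> * y)" for y
        using ab by (simp add: field_simps)
      ultimately show ?thesis by (simp only:)
    qed
    finally show ?thesis unfolding a_def b_def .
  qed
  moreover have "2 * c1 + c2 \<ge> 0" using C12 by (intro add_nonneg_nonneg) auto
  ultimately show ?thesis using that by blast
qed

text \<open>The quotient rule gives \<open>f' / (1 - u) + f / (1 - u)^2\<close>. Cauchy's estimate
  contributes \<open>2 * M\<close> to the constant, and \<open>1 - |u| \<le> |1 - u|\<close> turns
  the second term into the remaining \<open>M\<close>.\<close>

lemma norm_deriv_quotient_one_minus_le:
  fixes f :: "complex \<Rightarrow> complex"
  assumes f: "f holomorphic_on \<bbbD>" and M: "\<And>z. z \<in> \<bbbD> \<Longrightarrow> norm (f z) \<le> M" and u: "u \<in> \<bbbD>"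
  shows "norm (deriv (\<lambda>z. f z / (1 - z)) u) \<le> 3 * M * (1 / ((1 - norm u) * norm (1 - u)))"
proof -
  define q v where "q = 1 - norm u" and "v = norm (1 - u)"
  have "u \<noteq> 1" using u by auto
  have q: "q > 0" "q \<le> v" using u norm_triangle_ineq2[of 1 u] by (auto simp: q_def v_def)
  have "(f has_field_derivative deriv f u) (at u)"
    using f u by (intro holomorphic_derivI[of f \<bbbD>]) auto
  then have "((\<lambda>z. f z / (1 - z)) has_field_derivative
      (deriv f u * (1 - u) - f u * (0 - 1)) / ((1 - u) * (1 - u))) (at u)"
    using \<open>u \<noteq> 1\<close> by (intro derivative_intros) auto
  then have "deriv (\<lambda>z. f z / (1 - z)) u = (deriv f u * (1 - u) - f u * (0 - 1)) / ((1 - u) * (1 - u))"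
    by (rule DERIV_imp_deriv)
  then have d: "deriv (\<lambda>z. f z / (1 - z)) u = deriv f u / (1 - u) + f u / (1 - u)\<^sup>2"
    using \<open>u \<noteq> 1\<close> by (simp add: add_divide_distrib power2_eq_square)
  \<comment> \<open>Half the distance to the circle is used so that the closed disk stays inside
    \<open>\<bbbD>\<close>.\<close>
  have sub: "cball u (q / 2) \<subseteq> \<bbbD>"
  proof
    fix z assume "z \<in> cball u (q / 2)"
    then have "norm (z - u) \<le> q / 2" by (simp add: dist_norm norm_minus_commute)
    then show "z \<in> \<bbbD>" using norm_triangle_ineq[of "z - u" u] q by (simp add: q_def)
  qed
  have "norm ((deriv ^^ 1) f u) \<le> fact 1 * M / (q / 2) ^ 1"
  proof (rule Cauchy_inequality)
    show "f holomorphic_on ball u (q / 2)"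
      using f by (rule holomorphic_on_subset) (use sub in auto)
    show "continuous_on (cball u (q / 2)) f"
      using f sub holomorphic_on_imp_continuous_on continuous_on_subset by blast
    show "0 < q / 2" using q by simp
    show "norm (f x) \<le> M" if "norm (u - x) = q / 2" for x
      using that sub by (intro M) (auto simp: dist_norm subset_iff)
  qed
  then have df: "norm (deriv f u) \<le> 2 * M / q" by (simp add: mult.commute)
  have M0: "M \<ge> 0" using M[OF u] norm_ge_zero order_trans by blast
  have "norm (deriv (\<lambda>z. f z / (1 - z)) u) \<le> norm (deriv f u) / v + norm (f u) / v\<^sup>2"
    unfolding d v_def by (rule order_trans[OF norm_triangle_ineq]) (simp add: norm_divide norm_power)
  also have "norm (deriv f u) / v \<le> 2 * M / q / v"
    using df q by (intro divide_right_mono) auto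
  also have "norm (f u) / v\<^sup>2 \<le> M / (q * v)"
    using M[OF u] q M0 by (intro frac_le) (auto simp: power2_eq_square)
  finally show ?thesis by (simp add: q_def v_def field_simps)
qed

text \<open>The choice \<open>\<epsilon> = p/4\<close> makes the squared derivative bound carry
  exactly the exponents \<open>- (p/2)\<close> and \<open>p/2 - 2\<close> of
  \<open>disk_kernel_integral_bounded\<close>.\<close>

lemma cesaro_like_in_Q_if_carleson:
  fixes \<mu> :: "real measure" and p :: real
  assumes p: "0 < p" "p < 2" and \<mu>: "finite_borel_measure_on {0..<1} \<mu>"
    and "carleson_measure_on_unit_interval \<mu>" and "f \<in> Hardy_infty"
  shows "cesaro_like \<mu> f \<in> Q_space p"
proof -
  note sp = finite_borel_measure_on_unit_intervalD(2)[OF \<mu>]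
  have f: "f holomorphic_on \<bbbD>" using assms(5) by (simp add: Hardy_infty_def)
  obtain M where "\<forall>z\<in>\<bbbD>. norm (f z) \<le> M"
    using assms(5) by (auto simp: Hardy_infty_def bounded_iff)
  then have M: "\<And>z. z \<in> \<bbbD> \<Longrightarrow> norm (f z) \<le> M" by blast
  have M0: "M \<ge> 0" using M[of 0] norm_ge_zero[of "f 0"] by (simp del: norm_ge_zero)
  obtain K where K: "K \<ge> 0"
    "\<And>z. z \<in> \<bbbD> \<Longrightarrow> (\<integral>\<^sup>+t. ennreal (1 / ((1 - t * norm z) * norm (1 - of_real t * z))) \<partial>\<mu>)
      \<le> ennreal (K * ((1 - norm z) powr - (p/4) * norm (1 - z) powr (p/4 - 1)))"
    using carleson_kernel_bound[OF \<mu> assms(4), of "p/4"] p by auto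
  obtain L where L: "L \<ge> 0"
    "\<And>w. w \<in> \<bbbD> \<Longrightarrow> (\<integral>\<^sup>+z\<in>\<bbbD>. ennreal ((1 - norm z) powr - (p/2) * norm (1 - z) powr (p/2 - 2) *
      (1 - (cmod (disk_involution w z))\<^sup>2) powr p) \<partial>area_measure) \<le> ennreal L"
    using disk_kernel_integral_bounded[OF p] by blast
  let ?g = "cesaro_like \<mu> f" and ?h = "\<lambda>z. f z / (1 - z)"
  let ?k = "\<lambda>z t. of_real t * deriv ?h (of_real t * z)"
  define B where "B = 3 * M * K"
  have B0: "B \<ge> 0" using M0 K(1) by (simp add: B_def)
  have deriv_le: "norm (deriv ?g z) \<le> B * ((1 - norm z) powr - (p/4) * norm (1 - z) powr (p/4 - 1))"
    if z: "z \<in> \<bbbD>" for z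
  proof -
    have "ennreal (norm (deriv ?g z)) \<le> (\<integral>\<^sup>+t. norm (?k z t) \<partial>\<mu>)"
      using integral_norm_bound_ennreal[OF cesaro_like_deriv(2)[OF \<mu> f z]]
      by (simp only: cesaro_like_deriv(3)[OF \<mu> f z])
    also have "\<dots> \<le> (\<integral>\<^sup>+t. ennreal (3 * M) *
        ennreal (1 / ((1 - t * norm z) * norm (1 - of_real t * z))) \<partial>\<mu>)"
    proof (intro nn_integral_mono)
      fix t assume "t \<in> space \<mu>"
      then have t: "0 \<le> t" "t < 1" by (auto simp: sp)
      have nt: "norm (of_real t * z) = t * norm z" using t by (simp add: norm_mult)
      have tz: "of_real t * z \<in> \<bbbD>"
        using norm_one_minus_mult_bounds(2)[OF t] z nt by force
      have "norm (?k z t) \<le> 1 * norm (deriv ?h (of_real t * z))"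
        unfolding norm_mult using t by (intro mult_right_mono) auto
      also have "\<dots> \<le> 3 * M * (1 / ((1 - t * norm z) * norm (1 - of_real t * z)))"
        using norm_deriv_quotient_one_minus_le[OF f M tz] by (simp only: nt mult_1)
      finally show "ennreal (norm (?k z t))
          \<le> ennreal (3 * M) * ennreal (1 / ((1 - t * norm z) * norm (1 - of_real t * z)))"
        using M0 by (subst ennreal_mult'[symmetric]) (auto intro: ennreal_leI)
    qed
    also have "\<dots> = ennreal (3 * M) *
        (\<integral>\<^sup>+t. ennreal (1 / ((1 - t * norm z) * norm (1 - of_real t * z))) \<partial>\<mu>)"
      by (intro nn_integral_cmult finite_borel_measure_on_unit_intervalD(3)[OF \<mu>]) measurable
    also have "\<dots> \<le> ennreal (3 * M) *
        ennreal (K * ((1 - norm z) powr - (p/4) * norm (1 - z) powr (p/4 - 1)))"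
      by (intro mult_left_mono K(2) z) auto
    also have "\<dots> = ennreal (B * ((1 - norm z) powr - (p/4) * norm (1 - z) powr (p/4 - 1)))"
      using M0 K(1) by (simp add: B_def mult.assoc flip: ennreal_mult)
    finally show ?thesis using B0 by (simp add: ennreal_le_iff)
  qed
  have "Q_seminorm_sq p ?g \<le> ennreal (B\<^sup>2 * L)"
    unfolding Q_seminorm_sq_def
  proof (intro SUP_least)
    fix w :: complex assume w: "w \<in> \<bbbD>"
    let ?W = "\<lambda>z. (1 - (cmod (disk_involution w z))\<^sup>2) powr p"
    let ?F = "\<lambda>z. (1 - norm z) powr - (p/2) * norm (1 - z) powr (p/2 - 2) * ?W z"
    have [measurable]: "disk_involution w \<in> borel_measurable borel"
      unfolding disk_involution_def by measurable
    have "(\<integral>\<^sup>+z\<in>\<bbbD>. ennreal ((cmod (deriv ?g z))\<^sup>2 * ?W z) \<partial>area_measure)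
        \<le> (\<integral>\<^sup>+z. ennreal (B\<^sup>2) * (ennreal (?F z) * indicator \<bbbD> z) \<partial>area_measure)"
    proof (intro nn_integral_mono)
      fix z :: complex
      show "ennreal ((cmod (deriv ?g z))\<^sup>2 * ?W z) * indicator \<bbbD> z
          \<le> ennreal (B\<^sup>2) * (ennreal (?F z) * indicator \<bbbD> z)"
      proof (cases "z \<in> \<bbbD>")
        case True
        have sq: "(x powr e)\<^sup>2 = x powr (2 * e)" for x e :: real
          by (simp add: power2_eq_square flip: powr_add)
        have "(cmod (deriv ?g z))\<^sup>2
            \<le> (B * ((1 - norm z) powr - (p/4) * norm (1 - z) powr (p/4 - 1)))\<^sup>2"
          by (intro power_mono deriv_le True) auto
        also have "\<dots> = B\<^sup>2 * ((1 - norm z) powr - (p/2) * norm (1 - z) powr (p/2 - 2))"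
          by (simp add: power_mult_distrib sq)
        finally have "(cmod (deriv ?g z))\<^sup>2 * ?W z
            \<le> B\<^sup>2 * ((1 - norm z) powr - (p/2) * norm (1 - z) powr (p/2 - 2)) * ?W z"
          by (intro mult_right_mono) auto
        then have "ennreal ((cmod (deriv ?g z))\<^sup>2 * ?W z) \<le> ennreal (B\<^sup>2 * ?F z)"
          by (intro ennreal_leI) (simp only: mult.assoc)
        then show ?thesis using True by (simp add: ennreal_mult)
      qed simp
    qed
    also have "\<dots> = ennreal (B\<^sup>2) * (\<integral>\<^sup>+z\<in>\<bbbD>. ennreal (?F z) \<partial>area_measure)"
      by (intro nn_integral_cmult borel_measurable_times borel_measurable_indicator) (measurable, simp)
    also have "\<dots> \<le> ennreal (B\<^sup>2) * ennreal L"
      by (intro mult_left_mono L(2) w) auto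
    also have "\<dots> = ennreal (B\<^sup>2 * L)"
      using L(1) by (simp add: ennreal_mult)
    finally show "(\<integral>\<^sup>+z\<in>\<bbbD>. ennreal ((cmod (deriv ?g z))\<^sup>2 * ?W z) \<partial>area_measure)
        \<le> ennreal (B\<^sup>2 * L)" .
  qed
  also have "\<dots> < \<infinity>" by simp
  finally show ?thesis
    using cesaro_like_deriv(1)[OF \<mu> f] by (simp add: Q_space_def)
qed

theorem theorem3p1:
  fixes p :: real and \<mu> :: "real measure"
  assumes "0 < p" and "p < 2"
    and "finite_borel_measure_on {0..<1} \<mu>"
  shows "cesaro_like \<mu> ` Hardy_infty \<subseteq> Q_space p \<longleftrightarrow> carleson_measure_on_unit_interval \<mu>"
proof
  assume "cesaro_like \<mu> ` Hardy_infty \<subseteq> Q_space p"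
  moreover have "(\<lambda>_. 1) \<in> Hardy_infty" by (auto simp: Hardy_infty_def image_constant_conv)
  ultimately have "cesaro_like \<mu> (\<lambda>_. 1) \<in> Q_space p" by blast
  with assms show "carleson_measure_on_unit_interval \<mu>"
    by (intro carleson_if_cesaro_like_one_in_Q)
next
  assume "carleson_measure_on_unit_interval \<mu>"
  then show "cesaro_like \<mu> ` Hardy_infty \<subseteq> Q_space p"
    using assms cesaro_like_in_Q_if_carleson by blast
qed

end
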